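(* Let $\mu,\sigma\in\mathscr P_2(\mathbb R^d)$. Then $$\boldsymbol\partial^Sd_{\mathcal W}^2(\cdot,\sigma)(\mu)=\overline{\operatorname{conv}\Big(\big\{(\pi^x,-2(\pi^y-\pi^x))_\#\gamma:\gamma\in\Gamma_o(\mu,\sigma)\big\}\Big)}^{d_\mu}.$$
   Context: $\mathscr P_2(\cdot)$ denotes Borel probability measures with finite second moment; $d_{\mathcal W}$ is the 2-Wasserstein distance on $\mathscr P_2(\mathbb R^d)$; $\Gamma_o(\mu,\sigma)\subset\mathscr P_2(\mathbb R^{2d})$ is the set of optimal plans for the quadratic cost, with coordinates $(x,y)$ and projections $\pi^x,\pi^y$. $T\mathbb R^d=\mathbb R^d\times\mathbb R^d$ (points $(x,v)$), $T^2\mathbb R^d=\mathbb R^d\times(\mathbb R^d)^2$ (points $(x,v,w)$), with projections $\pi^x,\pi^v,\pi^w$. $\mathscr P_2(T\mathbb R^d)_\mu:=\{\xi\in\mathscr P_2(T\mathbb R^d):\pi^x_\#\xi=\mu\}$. Metric: $d_\mu^2(\zeta,\xi):=\inf_{\eta\in\Gamma_\mu(\zeta,\xi)}\int|v-w|^2d\eta(x,v,w)$, where $\Gamma_\mu(\zeta,\xi):=\{\eta\in\mathscr P_2(T^2\mathbb R^d):(\pi^x,\pi^v)_\#\eta=\zeta,\ (\pi^x,\pi^w)_\#\eta=\xi\}$. Convexity: $D\subset\mathscr P_2(T\mathbb R^d)_\mu$ is convex if for every $\zeta,\xi\in D$, $t\in[0,1]$ and every $\eta\in\Gamma_\mu(\zeta,\xi)$,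 $(\pi^x,(1-t)\pi^v+t\pi^w)_\#\eta\in D$; $\operatorname{conv}(C)$ is the smallest convex set containing $C$. Strong Fréchet superdifferential: for $\mathcal G:\mathscr P_2(\mathbb R^d)\to\mathbb R$, $\boldsymbol\partial^S\mathcal G(\mu)$ is the set of $\xi\in\mathscr P_2(T\mathbb R^d)_\mu$ such that for any $\boldsymbol\mu\in\mathscr P_2(\mathbb R^{3d})$ with $\pi^{1,2}_\#\boldsymbol\mu=\xi$ and $\pi^3_\#\boldsymbol\mu=\nu$, $$\mathcal G(\nu)\le\mathcal G(\mu)+\int\langle x_2,x_3-x_1\rangle\,d\boldsymbol\mu(x_1,x_2,x_3)+o(\|\pi^3-\pi^1\|_{\boldsymbol\mu}),$$ where $\|\pi^3-\pi^1\|_{\boldsymbol\mu}^2=\int|x_3-x_1|^2d\boldsymbol\mu$. *)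

theory Defs
  imports "HOL-Probability.Probability"
begin

definition P2 :: "'b::euclidean_space measure set" where
  "P2 = {M. sets M = sets borel \<and> prob_space M \<and> integrable M (\<lambda>z. (norm z)\<^sup>2)}"

definition plans :: "'a::euclidean_space measure \<Rightarrow> 'a measure \<Rightarrow> ('a \<times> 'a) measure set" where
  "plans \<mu> \<sigma> = {\<gamma> \<in> P2. distr \<gamma> borel fst = \<mu> \<and> distr \<gamma> borel snd = \<sigma>}"

definition transport_cost :: "('a::euclidean_space \<times> 'a) measure \<Rightarrow> real" where
  "transport_cost \<gamma> = (LINT (x, y)|\<gamma>. (norm (x - y))\<^sup>2)"

definition wasserstein :: "'a::euclidean_space measure \<Rightarrow> 'a measure \<Rightarrow> real" where
  "wasserstein \<mu> \<sigma> = sqrt (INF \<gamma>\<in>plans \<mu> \<sigma>. transport_cost \<gamma>)"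

definition optimal_plans :: "'a::euclidean_space measure \<Rightarrow> 'a measure \<Rightarrow> ('a \<times> 'a) measure set" where
  "optimal_plans \<mu> \<sigma> =
     {\<gamma> \<in> plans \<mu> \<sigma>. \<forall>\<gamma>'\<in>plans \<mu> \<sigma>. transport_cost \<gamma> \<le> transport_cost \<gamma>'}"

text \<open>
  In a pair of type \<open>'a \<times> 'a\<close> representing a point of the tangent bundle, the first component is
  the base point and the second the tangent vector; triples \<open>(x, v, w)\<close> carry two tangent
  vectors at the same base point.
\<close>

definition P2_over :: "'a::euclidean_space measure \<Rightarrow> ('a \<times> 'a) measure set" where
  "P2_over \<mu> = {\<xi> \<in> P2. distr \<xi> borel fst = \<mu>}"

text \<open>
  The base measure \<open>\<mu>\<close> is not an argument of \<open>fibre_plans\<close> and \<open>fibre_dist\<close>: it is the common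
  first marginal of \<open>\<zeta>\<close> and \<open>\<xi>\<close>. Both are only used for \<open>\<zeta>, \<xi> \<in> P2_over \<mu>\<close>, where
  \<open>fibre_plans \<zeta> \<xi>\<close> is nonempty and the infimum in \<open>fibre_dist\<close> is a genuine one.
\<close>

definition fibre_plans ::
  "('a::euclidean_space \<times> 'a) measure \<Rightarrow> ('a \<times> 'a) measure \<Rightarrow> ('a \<times> 'a \<times> 'a) measure set" where
  "fibre_plans \<zeta> \<xi> =
     {\<eta> \<in> P2. distr \<eta> borel (\<lambda>(x, v, w). (x, v)) = \<zeta> \<and> distr \<eta> borel (\<lambda>(x, v, w). (x, w)) = \<xi>}"

definition fibre_dist ::
  "('a::euclidean_space \<times> 'a) measure \<Rightarrow> ('a \<times> 'a) measure \<Rightarrow> real" where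
  "fibre_dist \<zeta> \<xi> = sqrt (INF \<eta>\<in>fibre_plans \<zeta> \<xi>. LINT (x, v, w)|\<eta>. (norm (v - w))\<^sup>2)"

definition fibre_closure ::
  "'a::euclidean_space measure \<Rightarrow> ('a \<times> 'a) measure set \<Rightarrow> ('a \<times> 'a) measure set" where
  "fibre_closure \<mu> A = {\<xi> \<in> P2_over \<mu>. \<forall>\<epsilon>>0. \<exists>\<zeta>\<in>A. fibre_dist \<zeta> \<xi> < \<epsilon>}"

text \<open>Convexity is required along every fibre plan, not only along optimal ones.\<close>

definition fibre_convex :: "'a::euclidean_space measure \<Rightarrow> ('a \<times> 'a) measure set \<Rightarrow> bool" where
  "fibre_convex \<mu> D \<longleftrightarrow> D \<subseteq> P2_over \<mu> \<and>
     (\<forall>\<zeta>\<in>D. \<forall>\<xi>\<in>D. \<forall>t\<in>{0..1}. \<forall>\<eta>\<in>fibre_plans \<zeta> \<xi>.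
        distr \<eta> borel (\<lambda>(x, v, w). (x, (1 - t) *\<^sub>R v + t *\<^sub>R w)) \<in> D)"

text \<open>
  The remainder \<open>o(\<parallel>\<pi>\<^sup>3 - \<pi>\<^sup>1\<parallel>)\<close> is uniform over all three-plans \<open>\<beta>\<close>: \<open>\<delta>\<close> depends only on \<open>\<epsilon>\<close>
  (and on \<open>G\<close>, \<open>\<mu>\<close>, \<open>\<xi>\<close>). Only the values of \<open>G\<close> on \<open>P2\<close> matter.
\<close>

definition strong_superdifferential ::
  "('a::euclidean_space measure \<Rightarrow> real) \<Rightarrow> 'a measure \<Rightarrow> ('a \<times> 'a) measure set" where
  "strong_superdifferential G \<mu> = {\<xi> \<in> P2_over \<mu>.
     \<forall>\<epsilon>>0. \<exists>\<delta>>0. \<forall>\<beta>\<in>(P2 :: ('a \<times> 'a \<times> 'a) measure set).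
       let n = sqrt (LINT (x1, x2, x3)|\<beta>. (norm (x3 - x1))\<^sup>2);
           \<nu> = distr \<beta> borel (\<lambda>(x1, x2, x3). x3)
       in distr \<beta> borel (\<lambda>(x1, x2, x3). (x1, x2)) = \<xi> \<and> n < \<delta> \<longrightarrow>
          G \<nu> \<le> G \<mu> + (LINT (x1, x2, x3)|\<beta>. x2 \<bullet> (x3 - x1)) + \<epsilon> * n}"

end

theory Submission imports Defs
begin

text \<open>
  An optimal plan gives the competitor \<open>(x\<^sub>3, x\<^sub>1 - x\<^sub>2 / 2)\<close> for the distance from \<open>\<nu>\<close> to \<open>\<sigma>\<close>, so its
  vector field lies in the superdifferential with remainder \<open>\<parallel>x\<^sub>3 - x\<^sub>1\<parallel>\<^sup>2\<close>; gluing plans along common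
  marginals shows that the superdifferential is convex and closed. For the converse, let \<open>(x, v, w)\<close>
  nearly minimise \<open>\<parallel>v - w\<parallel>\<close> with \<open>(x, v)\<close> in the hull and \<open>(x, w)\<close> distributed as \<open>\<xi>\<close>. Testing \<open>\<xi>\<close> along
  \<open>x + s (v - w)\<close> and letting \<open>s\<close> tend to 0 produces an optimal plan \<open>(x, y)\<close>, coupled with \<open>(x, v, w)\<close>,
  such that \<open>u = 2 (x - y)\<close> satisfies \<open>\<integral> \<langle>u, v - w\<rangle> \<le> \<integral> \<langle>w, v - w\<rangle>\<close>; unless \<open>\<parallel>v - w\<parallel>\<close> is
  small, a step from \<open>v\<close> towards \<open>u\<close> stays in the hull and comes strictly closer to \<open>w\<close>.

  Both gluing and the limit rest on Prokhorov's theorem on \<open>\<real>\<^sup>n\<close>; gluing is obtained as a weak limit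
  of approximate gluings, without disintegration of measures.
\<close>

section \<open>Coding sequences of random variables by a real one\<close>

text \<open>A measure \<mu> that charges small sets admits no transport maps, so every comparison
  needs a joint law: a test plan or a near-optimal plan is glued onto a given fibre plan, and all
  inequalities are then read off on one probability space. The joint law of \<open>(x, v, u)\<close>
  that comes out is whatever the gluing returns, with no optimality between \<open>v\<close> and
  \<open>u\<close>; a step from \<open>v\<close> to \<open>u\<close> stays in the hull only because
  convexity holds along every fibre plan.

  No closest point of the hull is available, so the final argument uses a near minimiser. Its slack
  is fixed after the step length \<open>t\<close>: with \<open>d\<close> the squared distance, the
  first-order gain \<open>2 * t * d\<close> has to absorb both the second-order term and the slack,
  each at most \<open>t * d\<close>.

  As \<open>s\<close> tends to 0, the pairing of \<open>x - y\<close> with \<open>v - w\<close> has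
  an unbounded integrand of no fixed sign, so weak convergence does not control it directly. It is
  recovered from the square of \<open>x - y + (v - w)\<close>, which is lower semicontinuous, by
  subtracting the transport cost of the limit plan, which is bounded below by the squared
  Wasserstein distance.\<close>

definition binary_digit :: "nat \<Rightarrow> real \<Rightarrow> real" where
  "binary_digit l u = of_int (\<lfloor>2 ^ Suc l * u\<rfloor> - 2 * \<lfloor>2 ^ l * u\<rfloor>)"

lemma binary_digit_cases: "binary_digit l u = 0 \<or> binary_digit l u = 1"
proof -
  have "\<lfloor>2 ^ Suc l * u\<rfloor> - 2 * \<lfloor>2 ^ l * u\<rfloor> = 0 \<or> \<lfloor>2 ^ Suc l * u\<rfloor> - 2 * \<lfloor>2 ^ l * u\<rfloor> = 1"
    unfolding power_Suc mult.assoc by linarith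
  then show ?thesis
    unfolding binary_digit_def by auto
qed

lemma binary_digit_measurable [measurable]: "binary_digit l \<in> borel_measurable borel"
  unfolding binary_digit_def by measurable

text \<open>The partial sums telescope to \<open>of_int \<lfloor>2 ^ n * u\<rfloor> / 2 ^ n\<close>,
  which lies within \<open>(1/2) ^ n\<close> of \<open>u\<close>. The telescoping starts at
  \<lfloor>u\<rfloor>, which is 0 on the half-open unit interval.\<close>

lemma binary_digit_sums:
  assumes "0 \<le> u" "u < 1"
  shows "(\<lambda>l. (1/2) ^ Suc l * binary_digit l u) sums u"
proof -
  have partial: "(\<Sum>l<n. (1/2) ^ Suc l * binary_digit l u) = of_int \<lfloor>2 ^ n * u\<rfloor> / 2 ^ n" for n
  proof (induction n)
    case 0
    have "\<lfloor>u\<rfloor> = 0"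
      using assms by (simp add: floor_eq_iff)
    then show ?case by simp
  next
    case (Suc n)
    have "(\<Sum>l<Suc n. (1/2) ^ Suc l * binary_digit l u)
        = of_int \<lfloor>2 ^ n * u\<rfloor> / 2 ^ n + (1/2) ^ Suc n * binary_digit n u"
      using Suc by simp
    also have "\<dots> = of_int \<lfloor>2 ^ Suc n * u\<rfloor> / 2 ^ Suc n"
      unfolding binary_digit_def by (simp add: field_simps power_one_over)
    finally show ?case .
  qed
  have "(\<lambda>n. of_int \<lfloor>2 ^ n * u\<rfloor> / 2 ^ n) \<longlonglongrightarrow> u"
  proof (rule real_tendsto_sandwich)
    show "\<forall>\<^sub>F n in sequentially. u - (1/2) ^ n \<le> of_int \<lfloor>2 ^ n * u\<rfloor> / 2 ^ n"
    proof (intro always_eventually allI)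
      fix n
      have "(2 ^ n * u - 1) / 2 ^ n \<le> of_int \<lfloor>2 ^ n * u\<rfloor> / 2 ^ n"
        by (intro divide_right_mono) (linarith, simp)
      then show "u - (1/2) ^ n \<le> of_int \<lfloor>2 ^ n * u\<rfloor> / 2 ^ n"
        by (simp add: diff_divide_distrib power_one_over)
    qed
    show "\<forall>\<^sub>F n in sequentially. of_int \<lfloor>2 ^ n * u\<rfloor> / 2 ^ n \<le> u"
    proof (intro always_eventually allI)
      fix n
      have "of_int \<lfloor>2 ^ n * u\<rfloor> \<le> 2 ^ n * u" by linarith
      then show "of_int \<lfloor>2 ^ n * u\<rfloor> / 2 ^ n \<le> u"
        by (simp add: field_simps)
    qed
    have "(\<lambda>n. u - (1/2) ^ n) \<longlonglongrightarrow> u - 0"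
      by (intro tendsto_intros LIMSEQ_power_zero) auto
    then show "(\<lambda>n. u - (1/2) ^ n) \<longlonglongrightarrow> u" by simp
  qed auto
  then show ?thesis
    unfolding sums_def partial .
qed

text \<open>Base-4 expansion with digits 1 and 2 only: the fractional part of \<open>4\<^sup>i r\<close> stays away from
  the integers, so that each digit is recovered by a continuous function of \<open>r\<close>.\<close>

definition digit_code :: "(nat \<Rightarrow> real) \<Rightarrow> real" where
  "digit_code b = (\<Sum>k. (1 + b k) * (1/4) ^ Suc k)"

text \<open>The sine sees only the fractional part of \<open>4 ^ i * r\<close>. On codes this part
  lies in [1/3, 5/12] for digit value 0 and in [7/12, 2/3] for digit value 1, where the sine is at
  least 1/2 or at most -1/2; the clamp then returns exactly 0 or 1.\<close>

definition decode_digit :: "nat \<Rightarrow> real \<Rightarrow> real" where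
  "decode_digit i r = max 0 (min 1 (1/2 - sin (2 * pi * (4 ^ i * r))))"

lemma digit_code_summable:
  assumes "\<And>k. b k = 0 \<or> b k = (1::real)"
  shows "summable (\<lambda>k. (1 + b k) * (1/4) ^ Suc k)"
proof (rule summable_comparison_test')
  show "summable (\<lambda>k. 2 * (1/4) ^ k :: real)"
    by (intro summable_mult summable_geometric) auto
  show "norm ((1 + b k) * (1/4) ^ Suc k) \<le> 2 * (1/4) ^ k" for k
    using assms[of k] by (auto simp: abs_mult power_abs)
qed

lemma digit_code_bounds:
  assumes "\<And>k. b k = 0 \<or> b k = (1::real)"
  shows "1/3 \<le> digit_code b" "digit_code b \<le> 2/3"
proof -
  have 1: "(\<lambda>k. (1/4) ^ Suc k :: real) sums (1/3)"
    using sums_mult[OF geometric_sums[of "1/4::real"], of "1/4"] by simp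
  have 2: "(\<lambda>k. 2 * (1/4) ^ Suc k :: real) sums (2/3)"
    using sums_mult[OF 1, of 2] by simp
  note s = digit_code_summable[of b, OF assms]
  have "(1/4) ^ Suc k \<le> (1 + b k) * (1/4) ^ Suc k" "(1 + b k) * (1/4) ^ Suc k \<le> 2 * (1/4) ^ Suc k" for k
    using assms[of k] by auto
  then show "1/3 \<le> digit_code b" "digit_code b \<le> 2/3"
    unfolding digit_code_def using sums_le[OF _ 1 summable_sums[OF s]] sums_le[OF _ summable_sums[OF s] 2]
    by auto
qed

lemma digit_code_unfold:
  assumes "\<And>k. b k = 0 \<or> b k = (1::real)"
  shows "4 * digit_code b = 1 + b 0 + digit_code (\<lambda>k. b (Suc k))"
proof -
  note s = digit_code_summable[of b, OF assms]
  have s': "summable (\<lambda>k. (1 + b (Suc k)) * (1/4) ^ Suc k)"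
    using digit_code_summable[of "\<lambda>k. b (Suc k)"] assms by simp
  have "digit_code b = (1 + b 0) / 4 + (\<Sum>k. (1 + b (Suc k)) * (1/4) ^ Suc (Suc k))"
    unfolding digit_code_def using suminf_split_head[OF s] by simp
  also have "(\<Sum>k. (1 + b (Suc k)) * (1/4) ^ Suc (Suc k)) = (\<Sum>k. 1/4 * ((1 + b (Suc k)) * (1/4) ^ Suc k))"
    by (simp add: mult_ac)
  also have "\<dots> = 1/4 * digit_code (\<lambda>k. b (Suc k))"
    unfolding digit_code_def by (rule suminf_mult[OF s'])
  finally show ?thesis by simp
qed

text \<open>Multiplication by 4 moves one digit across the point. The tail is again a code, hence
  lies between 1/3 and 2/3 and is the fractional part.\<close>

lemma digit_code_shift:
  assumes "\<And>k. b k = 0 \<or> b k = (1::real)"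
  shows "\<exists>m::int. 4 ^ i * digit_code b = of_int m + digit_code (\<lambda>k. b (i + k))"
proof (induction i)
  case 0
  show ?case by (auto intro!: exI[of _ 0])
next
  case (Suc i)
  then obtain m :: int where m: "4 ^ i * digit_code b = of_int m + digit_code (\<lambda>k. b (i + k))"
    by auto
  have "4 * digit_code (\<lambda>k. b (i + k)) = 1 + b i + digit_code (\<lambda>k. b (Suc i + k))"
    using digit_code_unfold[of "\<lambda>k. b (i + k)"] assms by simp
  then have "4 ^ Suc i * digit_code b = 4 * of_int m + 1 + b i + digit_code (\<lambda>k. b (Suc i + k))"
    using m by simp
  then show ?case
    using assms[of i]
    by (auto intro: exI[of _ "4 * m + 1"] exI[of _ "4 * m + 2"])
qed

lemma decode_digit_code:
  assumes "\<And>k. b k = 0 \<or> b k = (1::real)"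
  shows "decode_digit i (digit_code b) = b i"
proof -
  obtain m :: int where m: "4 ^ i * digit_code b = of_int m + digit_code (\<lambda>k. b (i + k))"
    using digit_code_shift[of b i, OF assms] by blast
  define t where "t = digit_code (\<lambda>k. b (i + k))"
  define t' where "t' = digit_code (\<lambda>k. b (Suc i + k))"
  have t: "4 * t = 1 + b i + t'"
    using digit_code_unfold[of "\<lambda>k. b (i + k)"] assms by (simp add: t_def t'_def)
  have t': "1/3 \<le> t'" "t' \<le> 2/3"
    using digit_code_bounds[of "\<lambda>k. b (Suc i + k)"] assms by (auto simp: t'_def)
  have sin_eq: "sin (2 * pi * (4 ^ i * digit_code b)) = sin (2 * pi * t)"
  proof -
    have "sin (2 * pi * (of_int m + t)) = sin (2 * pi * t + 2 * pi * of_int m)"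
      by (simp add: algebra_simps)
    also have "\<dots> = sin (2 * pi * t)"
      unfolding sin_add using sin_int_2pin[of m] cos_int_2pin[of m] by simp
    finally show ?thesis using m by (simp add: t_def)
  qed
  have half: "1/2 \<le> sin x" if "pi / 6 \<le> x" "x \<le> pi / 2" for x
    using sin_monotone_2pi_le[of "pi/6" x] that sin_30 by simp
  consider "b i = 0" | "b i = 1" using assms[of i] by auto
  then show ?thesis
  proof cases
    case 1
    \<comment> \<open>Here \<open>2 * pi * t\<close> lies between 2 pi/3 and 5 pi/6; the reflection
      at pi/2 brings it into the range of \<open>half\<close>. In the other case the shift by pi
      does the same.\<close>
    have "1/2 \<le> sin (pi - 2 * pi * t)"
    proof (rule half)
      have "pi * (2 * t) \<le> pi * (5/6)"
        using t t' 1 by (intro mult_left_mono) auto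
      then show "pi / 6 \<le> pi - 2 * pi * t" by simp
      have "pi * (1/2) \<le> pi * (2 * t)"
        using t t' 1 by (intro mult_left_mono) auto
      then show "pi - 2 * pi * t \<le> pi / 2" by simp
    qed
    then show ?thesis
      unfolding decode_digit_def sin_eq by (simp add: 1)
  next
    case 2
    have "1/2 \<le> sin (2 * pi * t - pi)"
    proof (rule half)
      have "pi * (7/6) \<le> pi * (2 * t)"
        using t t' 2 by (intro mult_left_mono) auto
      then show "pi / 6 \<le> 2 * pi * t - pi" by simp
      have "pi * (2 * t) \<le> pi * (3/2)"
        using t t' 2 by (intro mult_left_mono) auto
      then show "2 * pi * t - pi \<le> pi / 2" by simp
    qed
    then have "sin (2 * pi * t) \<le> - 1/2"
      by (simp add: sin_diff)
    then show ?thesis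
      unfolding decode_digit_def sin_eq by (simp add: 2)
  qed
qed

text \<open>A sequence of measurable functions factors through one real random variable, with
  continuous outer factors: this is how one-dimensional compactness is put to use on \<open>\<real>\<^sup>n\<close>.\<close>

lemma continuous_factorisation:
  fixes u :: "nat \<Rightarrow> 'a \<Rightarrow> real"
  assumes u: "\<And>j. u j \<in> borel_measurable M" and range: "\<And>j x. 0 \<le> u j x" "\<And>j x. u j x < 1"
  obtains \<phi> :: "'a \<Rightarrow> real" and q :: "nat \<Rightarrow> real \<Rightarrow> real"
  where "\<phi> \<in> borel_measurable M" "\<And>x. 0 < \<phi> x" "\<And>x. \<phi> x \<le> 1"
    "\<And>j. continuous_on UNIV (q j)" "\<And>j x. q j (\<phi> x) = u j x"
    "\<And>j r. 0 \<le> q j r" "\<And>j r. q j r \<le> 1"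
proof
  \<comment> \<open>The binary digits of all \<open>u j\<close> are interleaved by
    \<open>prod_decode\<close> into one sequence, so a single number encodes the whole
    family.\<close>
  define b where "b x k = (case prod_decode k of (j, l) \<Rightarrow> binary_digit l (u j x))" for x k
  have b01: "b x k = 0 \<or> b x k = 1" for x k
    unfolding b_def using binary_digit_cases by (auto split: prod.split)
  define \<phi> where "\<phi> x = digit_code (b x)" for x
  \<comment> \<open>\<open>q j\<close> is defined at every real and not only at codes: a weak limit
    of laws of \<phi> may charge points outside its range. The clamped digits keep the values in
    [0, 1] there.\<close>
  define q where "q j r = (\<Sum>l. (1/2) ^ Suc l * decode_digit (prod_encode (j, l)) r)" for j r
  have dd: "0 \<le> decode_digit i r" "decode_digit i r \<le> 1" for i r
    unfolding decode_digit_def by auto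
  have geo: "(\<lambda>l. (1/2) ^ Suc l :: real) sums 1"
    using sums_mult[OF geometric_sums[of "1/2::real"], of "1/2"] by simp
  have le: "(1/2) ^ Suc l * decode_digit i r \<le> (1/2) ^ Suc l" for l i r
    using dd[of i r] by (intro mult_left_le) auto
  have nn: "0 \<le> (1/2) ^ Suc l * decode_digit i r" for l i r
    using dd[of i r] by simp
  have sm: "summable (\<lambda>l. (1/2) ^ Suc l * decode_digit (prod_encode (j, l)) r)" for j r
    by (rule summable_comparison_test'[OF sums_summable[OF geo]])
       (simp add: abs_mult abs_of_nonneg[OF dd(1)] dd(2))
  have [measurable]: "(\<lambda>x. b x k) \<in> borel_measurable M" for k
    unfolding b_def using u by (cases "prod_decode k") (simp, measurable)
  show "\<phi> \<in> borel_measurable M"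
    unfolding \<phi>_def digit_code_def by measurable
  show "0 < \<phi> x" "\<phi> x \<le> 1" for x
    using digit_code_bounds[of "b x", OF b01] by (auto simp: \<phi>_def)
  show "0 \<le> q j r" "q j r \<le> 1" for j r
    unfolding q_def using suminf_nonneg[OF sm nn] sums_le[OF le summable_sums[OF sm] geo] by auto
  show "q j (\<phi> x) = u j x" for j x
  proof -
    have "decode_digit (prod_encode (j, l)) (\<phi> x) = binary_digit l (u j x)" for l
      unfolding \<phi>_def using decode_digit_code[of "b x", OF b01] by (simp add: b_def)
    then show ?thesis
      unfolding q_def using binary_digit_sums[OF range] by (simp add: sums_iff)
  qed
  \<comment> \<open>Each term is continuous and bounded by \<open>(1/2) ^ Suc l\<close>, so the
    series converges uniformly.\<close>
  show "continuous_on UNIV (q j)" for j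
  proof (rule uniform_limit_theorem)
    show "uniform_limit UNIV (\<lambda>n r. \<Sum>l<n. (1/2) ^ Suc l * decode_digit (prod_encode (j, l)) r) (q j) sequentially"
      unfolding q_def
      by (rule Weierstrass_m_test[OF _ sums_summable[OF geo]]) (simp add: abs_mult abs_of_nonneg[OF dd(1)] dd(2))
    show "\<forall>\<^sub>F n in sequentially. continuous_on UNIV (\<lambda>r. \<Sum>l<n. (1/2) ^ Suc l * decode_digit (prod_encode (j, l)) r)"
      unfolding decode_digit_def by (intro always_eventually allI continuous_intros)
  qed simp
qed

section \<open>Weak convergence and Prokhorov's theorem\<close>

lemma measurable_continuous_of_sets:
  assumes "sets M = sets borel" "continuous_on UNIV f"
  shows "f \<in> borel_measurable M"
  using borel_measurable_continuous_onI[OF assms(2)] assms(1) by (simp cong: measurable_cong_sets)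

lemma integrable_bounded_continuous:
  fixes f :: "'a::topological_space \<Rightarrow> real"
  assumes "prob_space M" "sets M = sets borel" "continuous_on UNIV f" "\<And>x. \<bar>f x\<bar> \<le> B"
  shows "integrable M f"
proof (rule finite_measure.integrable_const_bound)
  show "finite_measure M"
    using assms(1) by (rule prob_space.finite_measure)
  show "f \<in> borel_measurable M"
    using assms(2,3) by (rule measurable_continuous_of_sets)
qed (use assms in auto)

text \<open>The integrands decrease to the indicator of \<open>C\<close>, since off a closed set the
  distance is positive. For the empty set the convention \<open>infdist x {} = 0\<close> would make
  every integrand 1, hence the second assumption on \<open>C\<close>.\<close>

lemma closed_set_measure_limit:
  fixes C :: "'a::metric_space set"
  assumes "prob_space P" and s: "sets P = sets borel" and C: "closed C" "C \<noteq> {}"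
  shows "(\<lambda>n. \<integral>x. max 0 (1 - real n * infdist x C) \<partial>P) \<longlonglongrightarrow> measure P C"
proof -
  interpret prob_space P by fact
  have sp: "space P = UNIV" using sets_eq_imp_space_eq[OF s] by simp
  have [measurable]: "C \<in> sets P" using C s by simp
  have [measurable]: "(\<lambda>x. infdist x C) \<in> borel_measurable P"
    by (intro measurable_continuous_of_sets[OF s] continuous_intros)
  have "(\<lambda>n. \<integral>x. max 0 (1 - real n * infdist x C) \<partial>P) \<longlonglongrightarrow> (\<integral>x. indicator C x \<partial>P)"
  proof (rule integral_dominated_convergence[where w = "\<lambda>_. 1"])
    show "AE x in P. (\<lambda>n. max 0 (1 - real n * infdist x C)) \<longlonglongrightarrow> indicat_real C x"
    proof (rule AE_I2)
      fix x
      show "(\<lambda>n. max 0 (1 - real n * infdist x C)) \<longlonglongrightarrow> indicat_real C x"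
      proof (cases "x \<in> C")
        case False
        then have pos: "0 < infdist x C"
          using infdist_pos_not_in_closed C by blast
        obtain N :: nat where "1 / infdist x C < real N"
          using reals_Archimedean2 by blast
        then have N: "1 < real N * infdist x C"
          using pos by (simp add: field_simps)
        have "max 0 (1 - real n * infdist x C) = 0" if "n \<ge> N" for n
        proof -
          have "real N * infdist x C \<le> real n * infdist x C"
            using that pos by (intro mult_right_mono) auto
          then show ?thesis using N by simp
        qed
        then have "\<forall>\<^sub>F n in sequentially. max 0 (1 - real n * infdist x C) = 0"
          by (auto simp: eventually_sequentially)
        then show ?thesis
          using False by (simp add: tendsto_eventually)
      qed simp
    qed
    show "AE x in P. norm (max 0 (1 - real n * infdist x C)) \<le> 1" for n
      by (auto simp: infdist_nonneg)
  qed auto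
  then show ?thesis by (simp add: sp)
qed

text \<open>Closed sets form an intersection-stable generator, and their measures are limits of
  integrals of bounded continuous functions.\<close>

lemma borel_prob_eqI_bounded_continuous:
  fixes P Q :: "'a::metric_space measure"
  assumes P: "prob_space P" "sets P = sets borel" and Q: "prob_space Q" "sets Q = sets borel"
    and eq: "\<And>f. continuous_on UNIV f \<Longrightarrow> (\<And>x. \<bar>f x\<bar> \<le> (1::real)) \<Longrightarrow> integral\<^sup>L P f = integral\<^sup>L Q f"
  shows "P = Q"
proof (rule measure_eqI_generator_eq[where E = "Collect closed" and \<Omega> = UNIV and A = "\<lambda>_. UNIV"])
  interpret P: prob_space P by fact
  interpret Q: prob_space Q by fact
  show "Int_stable (Collect closed :: 'a set set)"
    by (auto simp: Int_stable_def)
  show "sets P = sigma_sets UNIV (Collect closed)" "sets Q = sigma_sets UNIV (Collect closed)"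
    using P Q by (simp_all add: borel_eq_closed)
  fix C :: "'a set" assume "C \<in> Collect closed"
  then have C: "closed C" by simp
  have "measure P C = measure Q C"
  proof (cases "C = {}")
    case False
    have "(\<lambda>n. \<integral>x. max 0 (1 - real n * infdist x C) \<partial>P) = (\<lambda>n. \<integral>x. max 0 (1 - real n * infdist x C) \<partial>Q)"
      by (intro ext eq continuous_intros) (auto simp: infdist_nonneg)
    then show ?thesis
      using closed_set_measure_limit[OF P C False] closed_set_measure_limit[OF Q C False]
      by (auto intro: LIMSEQ_unique)
  qed simp
  then show "emeasure P C = emeasure Q C"
    by (simp add: P.emeasure_eq_measure Q.emeasure_eq_measure)
qed (use P prob_space.finite_measure finite_measure.emeasure_finite in auto)

definition converges_weakly :: "(nat \<Rightarrow> 'a::topological_space measure) \<Rightarrow> 'a measure \<Rightarrow> bool" where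
  "converges_weakly M P \<longleftrightarrow> (\<forall>f :: 'a \<Rightarrow> real. continuous_on UNIV f \<longrightarrow> bounded (range f) \<longrightarrow>
     (\<lambda>k. integral\<^sup>L (M k) f) \<longlonglongrightarrow> integral\<^sup>L P f)"

lemma converges_weaklyD:
  fixes f :: "'a::topological_space \<Rightarrow> real"
  assumes "converges_weakly M P" "continuous_on UNIV f" "\<And>x. \<bar>f x\<bar> \<le> B"
  shows "(\<lambda>k. integral\<^sup>L (M k) f) \<longlonglongrightarrow> integral\<^sup>L P f"
  using assms unfolding converges_weakly_def by (auto intro!: boundedI[of _ B])

text \<open>Prokhorov's theorem. The code \<open>\<phi>\<close> turns it into Helly's selection theorem on \<open>[0, 1]\<close>;
  tightness keeps the limit off the points where the decoding \<open>\<psi>\<close> is discontinuous, which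
  correspond to infinite coordinates.\<close>

lemma tight_imp_weakly_convergent_subsequence:
  fixes M :: "nat \<Rightarrow> 'a::euclidean_space measure"
  assumes prob: "\<And>k. prob_space (M k)" and sets_M: "\<And>k. sets (M k) = sets borel"
    and tight: "\<And>\<epsilon>. 0 < \<epsilon> \<Longrightarrow> \<exists>R. \<forall>k. measure (M k) {x. R < norm x} < \<epsilon>"
  obtains r P where "strict_mono r" "prob_space P" "sets P = sets borel" "converges_weakly (M \<circ> r) P"
proof -
  interpret M: prob_space "M k" for k by (fact prob)
  have sp: "space (M k) = UNIV" for k
    using sets_eq_imp_space_eq[OF sets_M] by simp
  have meas_M: "measurable (M k) N = measurable borel N" for k and N :: "'c measure"
    using sets_M by (intro measurable_cong_sets) auto
  \<comment> \<open>Coordinates are squeezed into (0, 1); the ends 0 and 1, never attained, stand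
    for infinite values. The factorisation asks for a sequence, so \<open>from_nat_into\<close>
    repeats a basis vector at indices past the dimension.\<close>
  define u where "u j x = 1/2 + arctan (x \<bullet> from_nat_into Basis j) / pi" for j :: nat and x :: 'a
  have u_abs: "\<bar>u j x - 1/2\<bar> = arctan \<bar>x \<bullet> from_nat_into Basis j\<bar> / pi" for j x
  proof -
    have "\<bar>arctan y\<bar> = arctan \<bar>y\<bar>" for y
      by (cases "0 \<le> y") (auto simp: abs_if arctan_minus zero_le_arctan_iff arctan_less_zero_iff)
    then show ?thesis unfolding u_def by (simp add: abs_divide)
  qed
  have arctan_pi: "arctan y / pi < 1/2" for y
    using arctan_ubound[of y] by (simp add: field_simps)
  have u01: "0 < u j x" "u j x < 1" for j x
    using u_abs[of j x] arctan_pi[of "\<bar>x \<bullet> from_nat_into Basis j\<bar>"] by linarith+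
  have u_meas: "u j \<in> borel_measurable borel" for j
    unfolding u_def by (intro borel_measurable_continuous_onI continuous_intros) auto
  obtain \<phi> :: "'a \<Rightarrow> real" and q where \<phi>: "\<phi> \<in> borel_measurable borel" "\<And>x. 0 < \<phi> x" "\<And>x. \<phi> x \<le> 1"
    and q: "\<And>j. continuous_on UNIV (q j)" "\<And>j x. q j (\<phi> x) = u j x"
      "\<And>j r. 0 \<le> q j r" "\<And>j r. q j r \<le> 1"
    by (rule continuous_factorisation[of u borel, OF u_meas less_imp_le[OF u01(1)] u01(2)]) blast
  note [measurable] = \<phi>(1)
  have \<phi>_M [measurable]: "\<phi> \<in> borel_measurable (M k)" for k
    unfolding meas_M by (fact \<phi>(1))
  have q_meas [measurable]: "q j \<in> borel_measurable borel" for j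
    by (rule borel_measurable_continuous_onI[OF q(1)])
  define \<mu> where "\<mu> k = distr (M k) borel \<phi>" for k
  have \<mu>_real: "real_distribution (\<mu> k)" for k
    unfolding \<mu>_def real_distribution_def real_distribution_axioms_def
    by (auto intro!: M.prob_space_distr)
  \<comment> \<open>All image laws live on one bounded interval, so they are tight whatever
    \<open>M\<close> is. The tightness of \<open>M\<close> itself is spent in
    \<open>bad_null\<close>.\<close>
  have "measure (\<mu> k) {0<..1} = 1" for k
  proof -
    have "\<phi> -` {0<..1} \<inter> space (M k) = space (M k)"
      using \<phi> by auto
    then show ?thesis
      unfolding \<mu>_def by (subst measure_distr) (auto simp: M.prob_space)
  qed
  then have "Helly_Selection.tight \<mu>"
    unfolding tight_def using \<mu>_real
    by (intro conjI allI impI exI[of _ 0] exI[of _ 1]) simp_all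
  from tight_imp_convergent_subsubsequence[OF this strict_mono_id]
  obtain r m where r: "strict_mono r" and m: "real_distribution m" and conv: "weak_conv_m (\<mu> \<circ> r) m"
    by (auto simp: comp_def)
  interpret m: real_distribution m by fact
  have lim: "(\<lambda>k. \<integral>x. f (\<phi> x) \<partial>M (r k)) \<longlonglongrightarrow> integral\<^sup>L m f"
    if f: "f \<in> borel_measurable borel" "\<And>x. \<bar>f x\<bar> \<le> B" "emeasure m {x. \<not> isCont f x} = 0"
    for f :: "real \<Rightarrow> real" and B
  proof -
    have "(\<lambda>k. integral\<^sup>L ((\<mu> \<circ> r) k) f) \<longlonglongrightarrow> integral\<^sup>L m f"
      by (rule weak_conv_imp_bdd_ae_continuous_conv[where B = B]) (use \<mu>_real m conv f in \<open>auto simp: comp_def\<close>)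
    moreover have "integral\<^sup>L ((\<mu> \<circ> r) k) f = (\<integral>x. f (\<phi> x) \<partial>M (r k))" for k
      using f by (simp add: \<mu>_def integral_distr)
    ultimately show ?thesis by simp
  qed
  define ix where "ix e = to_nat_on Basis e" for e :: 'a
  have ix: "u (ix e) x = 1/2 + arctan (x \<bullet> e) / pi" if "e \<in> Basis" for e x
    unfolding u_def ix_def using that by (simp add: countable_finite)
  \<comment> \<open>As \<open>q\<close> takes values in [0, 1], these are the codes whose squeezed
    coordinate is 0 or 1, that is, infinite.\<close>
  define bad where "bad e = {r. 1/2 \<le> \<bar>q (ix e) r - 1/2\<bar>}" for e
  have bad_meas [measurable]: "bad e \<in> sets borel" for e
    unfolding bad_def by measurable
  have bad_null: "measure m (bad e) = 0" if e: "e \<in> Basis" for e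
  proof -
    have "measure m (bad e) \<le> \<epsilon>" if "0 < \<epsilon>" for \<epsilon>
    proof -
      obtain R where R: "\<And>k. measure (M k) {x. R < norm x} < \<epsilon>"
        using tight[OF \<open>0 < \<epsilon>\<close>] by auto
      define c where "c = arctan (max 0 R) / pi"
      have c: "c < 1/2" unfolding c_def by (rule arctan_pi)
      \<comment> \<open>A continuous cutoff between two levels: it vanishes when the coordinate is
        at most \<open>max 0 R\<close> in modulus and equals 1 on \<open>bad e\<close>. Its integral
        under each \<open>M k\<close> is therefore a bound by the tail, and this bound passes to the
        limit.\<close>
      define F where "F s = max 0 (min 1 ((\<bar>s - 1/2\<bar> - c) / (1/2 - c)))" for s :: real
      have F01: "0 \<le> F s" "F s \<le> 1" for s by (auto simp: F_def)
      have F_cont: "continuous_on UNIV (\<lambda>r. F (q (ix e) r))"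
        unfolding F_def using c by (intro continuous_intros q(1)) auto
      then have F_meas [measurable]: "(\<lambda>r. F (q (ix e) r)) \<in> borel_measurable borel"
        by (rule borel_measurable_continuous_onI)
      have ball_meas: "{x. R < norm x} \<in> sets (M k)" for k
        unfolding sets_M by measurable
      have "F (u (ix e) x) \<le> indicator {x. R < norm x} x" for x
      proof (cases "R < norm x")
        case False
        have "\<bar>x \<bullet> e\<bar> \<le> max 0 R"
          using Basis_le_norm[OF e, of x] False by linarith
        then have "arctan \<bar>x \<bullet> e\<bar> / pi \<le> c"
          unfolding c_def by (intro divide_right_mono) (auto simp: arctan_le_iff)
        then have "\<bar>u (ix e) x - 1/2\<bar> \<le> c"
          using u_abs[of "ix e" x] e by (simp add: ix_def countable_finite)
        then have "(\<bar>u (ix e) x - 1/2\<bar> - c) / (1/2 - c) \<le> 0"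
          using c by (intro divide_nonpos_pos) auto
        then show ?thesis using False by (simp add: F_def)
      qed (use F01 in auto)
      then have "(\<integral>x. F (q (ix e) (\<phi> x)) \<partial>M k) \<le> (\<integral>x. indicator {x. R < norm x} x \<partial>M k)" for k
        unfolding q(2) using F01 ball_meas u_meas[of "ix e"]
        by (intro integral_mono M.integrable_const_bound[where B = 1])
           (auto simp: meas_M F_def intro!: borel_measurable_max borel_measurable_min
             borel_measurable_divide borel_measurable_diff borel_measurable_abs)
      also have "(\<integral>x. indicator {x. R < norm x} x \<partial>M k) \<le> \<epsilon>" for k
        using R[of k] ball_meas[of k] by (simp add: sp)
      finally have "\<forall>k. (\<integral>x. F (q (ix e) (\<phi> x)) \<partial>M (r k)) \<le> \<epsilon>" by blast
      moreover have "(\<lambda>k. \<integral>x. F (q (ix e) (\<phi> x)) \<partial>M (r k)) \<longlonglongrightarrow> (\<integral>r. F (q (ix e) r) \<partial>m)"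
        using F_cont F01
        by (intro lim[of "\<lambda>r. F (q (ix e) r)" 1] F_meas) (auto simp: continuous_on_eq_continuous_at)
      ultimately have "(\<integral>r. F (q (ix e) r) \<partial>m) \<le> \<epsilon>"
        by (intro LIMSEQ_le_const2) auto
      moreover have "(\<integral>r. indicator (bad e) r \<partial>m) \<le> (\<integral>r. F (q (ix e) r) \<partial>m)"
      proof (intro integral_mono m.integrable_const_bound[where B = 1])
        fix r
        show "indicator (bad e) r \<le> F (q (ix e) r)"
          using F01 c by (auto simp: bad_def F_def indicator_def)
      qed (use F01 in auto)
      ultimately show ?thesis by simp
    qed
    then have "measure m (bad e) \<le> 0" by (rule field_le_epsilon) simp
    then show ?thesis by (simp add: measure_le_0_iff)
  qed
  \<comment> \<open>On bad codes the tangent is taken at a pole and has a mere default value; these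
    codes form a null set of the limit law, so both measurability and almost everywhere continuity
    survive.\<close>
  define \<psi> :: "real \<Rightarrow> 'a" where "\<psi> r = (\<Sum>e\<in>Basis. tan (pi * (q (ix e) r - 1/2)) *\<^sub>R e)" for r
  have \<psi>_meas [measurable]: "\<psi> \<in> borel_measurable borel"
    unfolding \<psi>_def tan_def by measurable
  have \<psi>_\<phi>: "\<psi> (\<phi> x) = x" for x
  proof -
    have "tan (pi * (q (ix e) (\<phi> x) - 1/2)) = x \<bullet> e" if "e \<in> Basis" for e
      using ix[OF that] by (simp add: q(2) tan_arctan)
    then show ?thesis
      unfolding \<psi>_def by (simp add: euclidean_representation)
  qed
  have \<psi>_cont: "isCont \<psi> r" if "\<And>e. e \<in> Basis \<Longrightarrow> r \<notin> bad e" for r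
    unfolding \<psi>_def
  proof (intro continuous_intros)
    fix e :: 'a assume e: "e \<in> Basis"
    show "isCont (q (ix e)) r"
      using q(1) by (simp add: continuous_on_eq_continuous_at)
    have *: "\<bar>q (ix e) r - 1/2\<bar> < 1/2"
      using that[OF e] by (simp add: bad_def)
    have "0 < cos (pi * (q (ix e) r - 1/2))"
    proof (rule cos_gt_zero_pi)
      have "pi * (- (1/2)) < pi * (q (ix e) r - 1/2)" "pi * (q (ix e) r - 1/2) < pi * (1/2)"
        using * by (intro mult_strict_left_mono; auto simp: abs_if split: if_splits)+
      then show "- (pi / 2) < pi * (q (ix e) r - 1/2)" "pi * (q (ix e) r - 1/2) < pi / 2"
        by simp_all
    qed
    then show "cos (pi * (q (ix e) r - 1/2)) \<noteq> 0" by simp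
  qed
  define P where "P = distr m borel \<psi>"
  have "converges_weakly (M \<circ> r) P"
    unfolding converges_weakly_def
  proof (intro allI impI)
    fix f :: "'a \<Rightarrow> real" assume f: "continuous_on UNIV f" "bounded (range f)"
    then obtain B where B: "\<And>x. \<bar>f x\<bar> \<le> B"
      by (auto simp: bounded_iff)
    have [measurable]: "f \<in> borel_measurable borel"
      by (rule borel_measurable_continuous_onI[OF f(1)])
    have "(\<lambda>k. \<integral>x. f (\<psi> (\<phi> x)) \<partial>M (r k)) \<longlonglongrightarrow> (\<integral>s. f (\<psi> s) \<partial>m)"
    proof (rule lim)
      have "{s. \<not> isCont (\<lambda>s. f (\<psi> s)) s} \<subseteq> (\<Union>e\<in>Basis. bad e)"
      proof (rule ccontr)
        assume "\<not> ?thesis"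
        then obtain s where s: "\<not> isCont (\<lambda>s. f (\<psi> s)) s" "\<And>e. e \<in> Basis \<Longrightarrow> s \<notin> bad e" by blast
        have "isCont f (\<psi> s)" using f(1) by (simp add: continuous_on_eq_continuous_at)
        then show False using \<psi>_cont[OF s(2)] s(1) isCont_o2[of s \<psi> f] by blast
      qed
      then have "emeasure m {s. \<not> isCont (\<lambda>s. f (\<psi> s)) s} \<le> emeasure m (\<Union>e\<in>Basis. bad e)"
        by (intro emeasure_mono) auto
      also have "\<dots> \<le> (\<Sum>e\<in>Basis. emeasure m (bad e))"
        by (intro emeasure_subadditive_finite) auto
      also have "\<dots> = 0"
        using bad_null by (simp add: m.emeasure_eq_measure)
      finally show "emeasure m {s. \<not> isCont (\<lambda>s. f (\<psi> s)) s} = 0" by simp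
    qed (use B in auto)
    then show "(\<lambda>k. integral\<^sup>L ((M \<circ> r) k) f) \<longlonglongrightarrow> integral\<^sup>L P f"
      unfolding P_def \<psi>_\<phi> by (simp add: integral_distr)
  qed
  moreover have "prob_space P"
    unfolding P_def by (intro m.prob_space_distr) simp
  ultimately show thesis
    using r that[of r P] by (simp add: P_def)
qed

section \<open>Couplings and gluing\<close>

lemma converges_weakly_const_unique:
  fixes N Q :: "'a::metric_space measure"
  assumes "converges_weakly (\<lambda>_. N) Q" "prob_space N" "sets N = sets borel" "prob_space Q" "sets Q = sets borel"
  shows "Q = N"
proof (rule borel_prob_eqI_bounded_continuous)
  fix f :: "'a \<Rightarrow> real" assume "continuous_on UNIV f" "\<And>x. \<bar>f x\<bar> \<le> 1"
  from converges_weaklyD[OF assms(1) this] show "integral\<^sup>L Q f = integral\<^sup>L N f"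
    by (simp add: LIMSEQ_const_iff)
qed (use assms in auto)

lemma converges_weakly_distr:
  fixes g :: "'a::topological_space \<Rightarrow> 'b::topological_space"
  assumes "converges_weakly M P" "continuous_on UNIV g" "\<And>k. sets (M k) = sets borel" "sets P = sets borel"
  shows "converges_weakly (\<lambda>k. distr (M k) borel g) (distr P borel g)"
  unfolding converges_weakly_def
proof (intro allI impI)
  fix f :: "'b \<Rightarrow> real" assume f: "continuous_on UNIV f" "bounded (range f)"
  then obtain B where B: "\<And>x. \<bar>f x\<bar> \<le> B" by (auto simp: bounded_iff)
  have "continuous_on UNIV (\<lambda>x. f (g x))"
    using f(1) assms(2) by (auto intro: continuous_on_compose2)
  then have "(\<lambda>k. \<integral>x. f (g x) \<partial>M k) \<longlonglongrightarrow> (\<integral>x. f (g x) \<partial>P)"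
    by (rule converges_weaklyD[OF assms(1)]) (rule B)
  moreover have "g \<in> borel_measurable (M k)" "g \<in> borel_measurable P" for k
    using assms by (auto intro: measurable_continuous_of_sets)
  ultimately show "(\<lambda>k. integral\<^sup>L (distr (M k) borel g) f) \<longlonglongrightarrow> integral\<^sup>L (distr P borel g) f"
    using f(1) by (simp add: integral_distr borel_measurable_continuous_onI)
qed

text \<open>Lower semicontinuity of nonnegative costs. The truncations
  \<open>min (real N) (f x)\<close> are admissible test functions and lie below \<open>f\<close>;
  letting \<open>N\<close> grow recovers the integral of \<open>f\<close>. Quadratic costs are
  unbounded, so only this one-sided bound passes to limits.\<close>

lemma converges_weakly_integral_le:
  fixes f :: "'a::topological_space \<Rightarrow> real"
  assumes conv: "converges_weakly M P" and prob: "\<And>k. prob_space (M k)" "\<And>k. sets (M k) = sets borel"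
    and "prob_space P" "sets P = sets borel"
    and f: "continuous_on UNIV f" "\<And>x. 0 \<le> f x" "\<And>k. integrable (M k) f" "integrable P f"
    and le: "\<And>k. integral\<^sup>L (M k) f \<le> c k" and c: "c \<longlonglongrightarrow> c0"
  shows "integral\<^sup>L P f \<le> c0"
proof -
  have trunc: "(\<integral>x. min (real N) (f x) \<partial>P) \<le> c0" for N
  proof (rule LIMSEQ_le[OF _ c])
    have cont: "continuous_on UNIV (\<lambda>x. min (real N) (f x))"
      using f(1) by (intro continuous_intros)
    have bdd: "\<bar>min (real N) (f x)\<bar> \<le> real N" for x
      using f(2)[of x] by auto
    show "(\<lambda>k. \<integral>x. min (real N) (f x) \<partial>M k) \<longlonglongrightarrow> (\<integral>x. min (real N) (f x) \<partial>P)"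
      by (rule converges_weaklyD[OF conv cont bdd])
    have "(\<integral>x. min (real N) (f x) \<partial>M k) \<le> integral\<^sup>L (M k) f" for k
      using integrable_bounded_continuous[OF prob(1) prob(2) cont bdd] f
      by (intro integral_mono) auto
    then show "\<exists>k0. \<forall>k\<ge>k0. (\<integral>x. min (real N) (f x) \<partial>M k) \<le> c k"
      using le order_trans by blast
  qed
  have "(\<lambda>N. \<integral>x. min (real N) (f x) \<partial>P) \<longlonglongrightarrow> integral\<^sup>L P f"
  proof (rule integral_dominated_convergence[OF _ _ f(4)])
    show [measurable]: "f \<in> borel_measurable P"
      using f(4) by simp
    show "(\<lambda>x. min (real N) (f x)) \<in> borel_measurable P" for N by simp
    show "AE x in P. norm (min (real N) (f x)) \<le> f x" for N
      using f(2) by (intro AE_I2) (auto simp: min_def)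
    show "AE x in P. (\<lambda>N. min (real N) (f x)) \<longlonglongrightarrow> f x"
    proof (intro AE_I2 tendsto_eventually)
      fix x
      obtain n :: nat where "f x \<le> real n" using real_arch_simple by blast
      then show "\<forall>\<^sub>F N in sequentially. min (real N) (f x) = f x"
        by (intro eventually_sequentiallyI[of n]) (auto simp: min_def)
    qed
  qed
  then show ?thesis
    by (rule LIMSEQ_le_const2) (use trunc in auto)
qed

text \<open>The two factors may be different spaces, as gluing requires. Second moments do not
  appear because they are inherited from the marginals.\<close>

definition couplings :: "'a::euclidean_space measure \<Rightarrow> 'b::euclidean_space measure \<Rightarrow> ('a \<times> 'b) measure set" where
  "couplings M N = {P. sets P = sets borel \<and> prob_space P \<and> distr P borel fst = M \<and> distr P borel snd = N}"

lemma couplingsD: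
  assumes "P \<in> couplings M N"
  shows "sets P = sets borel" "prob_space P" "distr P borel fst = M" "distr P borel snd = N"
    "fst \<in> borel_measurable P" "snd \<in> borel_measurable P" "space P = UNIV"
  using assms sets_eq_imp_space_eq[of P borel]
  by (auto simp: couplings_def intro!: measurable_continuous_of_sets continuous_intros)

lemma couplings_marginals:
  assumes "P \<in> couplings M N"
  shows "prob_space M" "sets M = sets borel" "prob_space N" "sets N = sets borel"
proof -
  note P = couplingsD[OF assms]
  show "prob_space M" "prob_space N"
    using prob_space.prob_space_distr[OF P(2,5)] prob_space.prob_space_distr[OF P(2,6)]
    unfolding P(3,4) by auto
  show "sets M = sets borel" "sets N = sets borel"
    using sets_distr[of P borel fst] sets_distr[of P borel snd] unfolding P(3,4) by auto
qed

lemma prob_tail_small: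
  fixes M :: "'a::euclidean_space measure"
  assumes "prob_space M" "sets M = sets borel" "0 < \<epsilon>"
  obtains R where "measure M {x. R < norm x} < \<epsilon>"
proof -
  interpret prob_space M by fact
  have "(\<lambda>n. measure M {x. real n < norm x}) \<longlonglongrightarrow> measure M (\<Inter>n. {x. real n < norm x})"
  proof (rule finite_Lim_measure_decseq)
    show "range (\<lambda>n. {x. real n < norm x}) \<subseteq> sets M"
      unfolding assms(2) by (auto intro!: borel_open open_Collect_less continuous_intros)
    show "decseq (\<lambda>n. {x::'a. real n < norm x})"
      by (rule decseq_SucI) auto
  qed
  moreover have "(\<Inter>n. {x::'a. real n < norm x}) = {}"
    by auto (meson not_less real_arch_simple)
  ultimately have "(\<lambda>n. measure M {x. real n < norm x}) \<longlonglongrightarrow> 0" by simp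
  then have "\<forall>\<^sub>F n in sequentially. measure M {x. real n < norm x} < \<epsilon>"
    using \<open>0 < \<epsilon>\<close> by (rule order_tendstoD)
  then show thesis
    using that by (auto simp: eventually_sequentially)
qed

text \<open>Fixed marginals force tightness: if the norm of a pair exceeds \<open>R1 + R2\<close>,
  one of its components has left its ball. Projections are continuous, so the limit has the same
  marginals.\<close>

lemma couplings_compact:
  fixes P :: "nat \<Rightarrow> ('a::euclidean_space \<times> 'b::euclidean_space) measure"
  assumes P: "\<And>k. P k \<in> couplings M N"
  obtains r Q where "strict_mono r" "Q \<in> couplings M N" "converges_weakly (P \<circ> r) Q"
proof -
  note marg = couplings_marginals[OF P]
  note Pk = couplingsD[OF P]
  have "\<exists>R. \<forall>k. measure (P k) {z. R < norm z} < \<epsilon>" if "0 < \<epsilon>" for \<epsilon>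
  proof -
    have half: "0 < \<epsilon>/2" using that by simp
    obtain R1 where R1: "measure M {x. R1 < norm x} < \<epsilon>/2"
      by (rule prob_tail_small[OF marg(1,2) half])
    obtain R2 where R2: "measure N {x. R2 < norm x} < \<epsilon>/2"
      by (rule prob_tail_small[OF marg(3,4) half])
    have "measure (P k) {z. R1 + R2 < norm z} < \<epsilon>" for k
    proof -
      interpret prob_space "P k" by (rule Pk)
      let ?A = "{z :: 'a \<times> 'b. R1 < norm (fst z)}" and ?B = "{z :: 'a \<times> 'b. R2 < norm (snd z)}"
      have [simp]: "?A \<in> sets (P k)" "?B \<in> sets (P k)"
        unfolding Pk by (auto intro!: borel_open open_Collect_less continuous_intros)
      have "measure (P k) {z. R1 + R2 < norm z} \<le> measure (P k) (?A \<union> ?B)"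
      proof (rule finite_measure_mono)
        have "norm z \<le> norm (fst z) + norm (snd z)" for z :: "'a \<times> 'b"
          using norm_Pair_le[of "fst z" "snd z"] by simp
        then show "{z. R1 + R2 < norm z} \<subseteq> ?A \<union> ?B"
          by (auto simp: not_less) (smt (verit, best))
      qed (rule sets.Un; simp)
      also have "\<dots> \<le> measure (P k) ?A + measure (P k) ?B"
        by (rule measure_Un_le) auto
      also have "measure (P k) ?A = measure M {x. R1 < norm x}"
        unfolding Pk(3)[of k, symmetric] by (subst measure_distr) (auto simp: Pk vimage_def)
      also have "measure (P k) ?B = measure N {x. R2 < norm x}"
        unfolding Pk(4)[of k, symmetric] by (subst measure_distr) (auto simp: Pk vimage_def)
      finally show ?thesis using R1 R2 by simp
    qed
    then show ?thesis by blast
  qed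
  from tight_imp_weakly_convergent_subsequence[OF Pk(2) Pk(1) this]
  obtain r Q where r: "strict_mono r" and Q: "prob_space Q" "sets Q = sets borel"
    and conv: "converges_weakly (P \<circ> r) Q" by metis
  have meas: "fst \<in> borel_measurable Q" "snd \<in> borel_measurable Q"
    by (auto intro!: measurable_continuous_of_sets[OF Q(2)] continuous_intros)
  have "converges_weakly (\<lambda>k. distr ((P \<circ> r) k) borel fst) (distr Q borel fst)"
    "converges_weakly (\<lambda>k. distr ((P \<circ> r) k) borel snd) (distr Q borel snd)"
    using Pk Q by (intro converges_weakly_distr[OF conv] continuous_intros; simp)+
  then have "distr Q borel fst = M" "distr Q borel snd = N"
    using Pk marg prob_space.prob_space_distr[OF Q(1) meas(1)] prob_space.prob_space_distr[OF Q(1) meas(2)]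
    by (auto intro!: converges_weakly_const_unique)
  then show thesis
    using that[OF r _ conv] Q by (simp add: couplings_def)
qed

text \<open>The density of \<open>Q\<close> conditioned on one cell integrates to 1; on a null cell
  the convention \<open>1 / 0 = 0\<close> makes it vanish. Both marginals in the approximate gluing
  rest on it.\<close>

lemma normalised_cell_integral:
  assumes "prob_space Q" "h \<in> measurable Q (count_space UNIV)"
  shows "(\<integral>\<^sup>+b. (if h b = i then ennreal (1 / measure Q {b \<in> space Q. h b = i}) else 0) \<partial>Q)
    = (if measure Q {b \<in> space Q. h b = i} = 0 then 0 else 1)"
proof -
  interpret prob_space Q by fact
  note [measurable] = assms(2)
  let ?S = "{b \<in> space Q. h b = i}"
  have [measurable]: "?S \<in> sets Q" by measurable
  have "(\<integral>\<^sup>+b. (if h b = i then ennreal (1 / measure Q ?S) else 0) \<partial>Q)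
      = (\<integral>\<^sup>+b. ennreal (1 / measure Q ?S) * indicator ?S b \<partial>Q)"
    by (intro nn_integral_cong) auto
  also have "\<dots> = ennreal (1 / measure Q ?S) * ennreal (measure Q ?S)"
    by (subst nn_integral_cmult_indicator) (auto simp: emeasure_eq_measure)
  also have "\<dots> = (if measure Q ?S = 0 then 0 else 1)"
    by (simp flip: ennreal_mult)
  finally show ?thesis .
qed

text \<open>The product measure is reweighted so as to live on pairs of points over the same small cell.\<close>

lemma approximate_gluing:
  fixes f :: "'a::euclidean_space \<Rightarrow> 'c::{metric_space, second_countable_topology}" and g :: "'b::euclidean_space \<Rightarrow> 'c"
  assumes M: "prob_space M" "sets M = sets borel" and N: "prob_space N" "sets N = sets borel"
    and [measurable]: "f \<in> borel_measurable borel" "g \<in> borel_measurable borel"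
    and eq: "distr M borel f = distr N borel g" and \<kappa>: "0 < \<kappa>"
  obtains P where "P \<in> couplings M N" "AE z in P. dist (f (fst z)) (g (snd z)) < \<kappa>"
proof -
  interpret M: prob_space M by fact
  interpret N: prob_space N by fact
  interpret MN: pair_prob_space M N ..
  note [measurable_cong] = M(2) N(2)
  have sp [simp]: "space M = UNIV" "space N = UNIV"
    using sets_eq_imp_space_eq[OF M(2)] sets_eq_imp_space_eq[OF N(2)] by auto
  obtain D :: "'c set" where D: "countable D" "\<And>X. open X \<Longrightarrow> X \<noteq> {} \<Longrightarrow> \<exists>d\<in>D. d \<in> X"
    using countable_dense_setE by blast
  define d where "d = from_nat_into D"
  have ex_d: "\<exists>i. dist x (d i) < \<kappa>/2" for x
  proof -
    obtain y where y: "y \<in> D" "dist x y < \<kappa>/2"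
      using D(2)[of "ball x (\<kappa>/2)"] \<kappa> by (auto simp: mem_ball)
    then show ?thesis
      using from_nat_into_surj[OF D(1) y(1)] by (auto simp: d_def)
  qed
  \<comment> \<open>The least index of a dense point within \<kappa>/2 gives a countable measurable
    partition in which two points of one cell are less than \<kappa> apart.\<close>
  define cell where "cell x = (LEAST i. dist x (d i) < \<kappa>/2)" for x
  have cell: "dist x (d (cell x)) < \<kappa>/2" for x
    unfolding cell_def by (rule LeastI_ex[OF ex_d])
  have [measurable]: "cell \<in> measurable borel (count_space UNIV)"
    unfolding cell_def by measurable
  define p where "p i = measure M {a. cell (f a) = i}" for i
  have p_N: "p i = measure N {b. cell (g b) = i}" for i
  proof -
    have "p i = measure (distr M borel f) {x. cell x = i}"
      unfolding p_def by (subst measure_distr) (auto simp: vimage_def)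
    also have "\<dots> = measure N {b. cell (g b) = i}"
      unfolding eq by (subst measure_distr) (auto simp: vimage_def)
    finally show ?thesis .
  qed
  \<comment> \<open>Under this density, given the first point, the second is drawn from
    \<open>N\<close> conditioned on the same cell, and symmetrically. That is consistent because the
    cells have the same mass \<open>p\<close> under both images.\<close>
  define dens where "dens = (\<lambda>z. if cell (f (fst z)) = cell (g (snd z)) then ennreal (1 / p (cell (f (fst z)))) else 0)"
  have [measurable]: "p \<in> borel_measurable (count_space UNIV)" by simp
  have "Measurable.pred (M \<Otimes>\<^sub>M N) (\<lambda>z. \<exists>i. cell (f (fst z)) = i \<and> cell (g (snd z)) = i)"
    by measurable
  then have [measurable]: "Measurable.pred (M \<Otimes>\<^sub>M N) (\<lambda>z. cell (f (fst z)) = cell (g (snd z)))"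
    by (simp add: eq_commute)
  have dens_meas [measurable]: "dens \<in> borel_measurable (M \<Otimes>\<^sub>M N)"
    unfolding dens_def by measurable
  define P where "P = density (M \<Otimes>\<^sub>M N) dens"
  have sets_P: "sets P = sets borel"
    using sets_pair_measure_cong[OF M(2) N(2)] unfolding borel_prod by (simp add: P_def)
  have [measurable_cong]: "sets P = sets (M \<Otimes>\<^sub>M N)"
    unfolding P_def by simp
  have "AE a in M. \<forall>i. p i = 0 \<longrightarrow> cell (f a) \<noteq> i"
    unfolding AE_all_countable
  proof
    fix i
    show "AE a in M. p i = 0 \<longrightarrow> cell (f a) \<noteq> i"
    proof (cases "p i = 0")
      case True
      then have "{a. cell (f a) = i} \<in> null_sets M"
        unfolding p_def by (auto simp: null_sets_def M.emeasure_eq_measure M(2) intro!: measurable_sets_borel)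
      then show ?thesis by (rule AE_I') auto
    qed simp
  qed
  then have AE_M: "AE a in M. p (cell (f a)) \<noteq> 0" by eventually_elim auto
  have "AE b in N. \<forall>i. p i = 0 \<longrightarrow> cell (g b) \<noteq> i"
    unfolding AE_all_countable
  proof
    fix i
    show "AE b in N. p i = 0 \<longrightarrow> cell (g b) \<noteq> i"
    proof (cases "p i = 0")
      case True
      then have "{b. cell (g b) = i} \<in> null_sets N"
        unfolding p_N by (auto simp: null_sets_def N.emeasure_eq_measure N(2) intro!: measurable_sets_borel)
      then show ?thesis by (rule AE_I') auto
    qed simp
  qed
  then have AE_N: "AE b in N. p (cell (g b)) \<noteq> 0" by eventually_elim auto
  have space_P: "space P = UNIV" using sets_eq_imp_space_eq[OF sets_P] by simp
  have fst_P [measurable]: "fst \<in> borel_measurable P" and snd_P [measurable]: "snd \<in> borel_measurable P"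
    by (auto intro!: measurable_continuous_of_sets[OF sets_P] continuous_intros)
  have density_fst: "emeasure (distr P borel fst) A = (\<integral>\<^sup>+z. dens z * indicator A (fst z) \<partial>(M \<Otimes>\<^sub>M N))"
    if "A \<in> sets borel" for A
  proof -
    have "fst -` A \<in> sets (M \<Otimes>\<^sub>M N)"
      using measurable_sets[OF fst_P that] by (simp add: space_P) (simp add: P_def)
    then have "emeasure P (fst -` A) = (\<integral>\<^sup>+z. dens z * indicator (fst -` A) z \<partial>(M \<Otimes>\<^sub>M N))"
      unfolding P_def by (rule emeasure_density[OF dens_meas])
    then show ?thesis
      using that by (simp add: emeasure_distr space_P indicator_def)
  qed
  have density_snd: "emeasure (distr P borel snd) A = (\<integral>\<^sup>+z. dens z * indicator A (snd z) \<partial>(M \<Otimes>\<^sub>M N))"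
    if "A \<in> sets borel" for A
  proof -
    have "snd -` A \<in> sets (M \<Otimes>\<^sub>M N)"
      using measurable_sets[OF snd_P that] by (simp add: space_P) (simp add: P_def)
    then have "emeasure P (snd -` A) = (\<integral>\<^sup>+z. dens z * indicator (snd -` A) z \<partial>(M \<Otimes>\<^sub>M N))"
      unfolding P_def by (rule emeasure_density[OF dens_meas])
    then show ?thesis
      using that by (simp add: emeasure_distr space_P indicator_def)
  qed
  \<comment> \<open>By Fubini the inner integral over the second point is 1 unless the cell of the
    first point is null, and \<open>AE_M\<close> excludes such points up to a null set.\<close>
  have fst_marg: "distr P borel fst = M"
  proof (rule measure_eqI)
    fix A assume "A \<in> sets (distr P borel fst)"
    then have [measurable]: "A \<in> sets borel" by simp
    have "emeasure (distr P borel fst) A = (\<integral>\<^sup>+z. dens z * indicator A (fst z) \<partial>(M \<Otimes>\<^sub>M N))"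
      by (rule density_fst) simp
    also have "\<dots> = (\<integral>\<^sup>+a. \<integral>\<^sup>+b. dens (a, b) * indicator A a \<partial>N \<partial>M)"
      by (subst N.nn_integral_fst[symmetric]) auto
    also have "\<dots> = (\<integral>\<^sup>+a. indicator A a \<partial>M)"
    proof (rule nn_integral_cong_AE)
      show "AE a in M. (\<integral>\<^sup>+b. dens (a, b) * indicator A a \<partial>N) = indicator A a"
        using AE_M
      proof eventually_elim
        case (elim a)
        have "(\<integral>\<^sup>+b. dens (a, b) * indicator A a \<partial>N) = (\<integral>\<^sup>+b. dens (a, b) \<partial>N) * indicator A a"
          by (rule nn_integral_multc) (simp add: dens_def)
        also have "(\<integral>\<^sup>+b. dens (a, b) \<partial>N) = 1"
          using normalised_cell_integral[OF N(1), of "\<lambda>b. cell (g b)" "cell (f a)"] elim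
          unfolding dens_def p_N fst_conv snd_conv sp by (simp add: eq_commute[of "cell (f a)"] cong del: if_weak_cong)
        finally show ?case by simp
      qed
    qed
    finally show "emeasure (distr P borel fst) A = emeasure M A"
      by (simp add: M(2))
  qed (simp add: M(2))
  have snd_marg: "distr P borel snd = N"
  proof (rule measure_eqI)
    fix A assume "A \<in> sets (distr P borel snd)"
    then have [measurable]: "A \<in> sets borel" by simp
    have "emeasure (distr P borel snd) A = (\<integral>\<^sup>+z. dens z * indicator A (snd z) \<partial>(M \<Otimes>\<^sub>M N))"
      by (rule density_snd) simp
    also have "\<dots> = (\<integral>\<^sup>+b. \<integral>\<^sup>+a. dens (a, b) * indicator A b \<partial>M \<partial>N)"
      by (subst MN.nn_integral_snd[symmetric]) auto
    also have "\<dots> = (\<integral>\<^sup>+b. indicator A b \<partial>N)"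
    proof (rule nn_integral_cong_AE)
      show "AE b in N. (\<integral>\<^sup>+a. dens (a, b) * indicator A b \<partial>M) = indicator A b"
        using AE_N
      proof eventually_elim
        case (elim b)
        have "(\<integral>\<^sup>+a. dens (a, b) * indicator A b \<partial>M) = (\<integral>\<^sup>+a. dens (a, b) \<partial>M) * indicator A b"
          by (rule nn_integral_multc) (simp add: dens_def)
        also have "(\<integral>\<^sup>+a. dens (a, b) \<partial>M)
            = (\<integral>\<^sup>+a. (if cell (f a) = cell (g b) then ennreal (1 / p (cell (g b))) else 0) \<partial>M)"
          unfolding dens_def fst_conv snd_conv by (intro nn_integral_cong) auto
        also have "\<dots> = 1"
          using normalised_cell_integral[OF M(1), of "\<lambda>a. cell (f a)" "cell (g b)"] elim
          unfolding p_def sp by (simp cong del: if_weak_cong)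
        finally show ?case by simp
      qed
    qed
    finally show "emeasure (distr P borel snd) A = emeasure N A"
      by (simp add: N(2))
  qed (simp add: N(2))
  have "emeasure (distr P borel fst) UNIV = 1"
    unfolding fst_marg using M.emeasure_space_1 by simp
  then have "prob_space P"
    by (intro prob_spaceI) (simp add: emeasure_distr space_P)
  then have "P \<in> couplings M N"
    unfolding couplings_def using sets_P fst_marg snd_marg by simp
  moreover have "AE z in P. dist (f (fst z)) (g (snd z)) < \<kappa>"
    unfolding P_def AE_density[OF dens_meas]
  proof (rule AE_I2, rule impI)
    fix z assume "0 < dens z"
    then have "cell (f (fst z)) = cell (g (snd z))"
      unfolding dens_def by (auto split: prod.splits if_splits)
    then show "dist (f (fst z)) (g (snd z)) < \<kappa>"
      using cell[of "f (fst z)"] cell[of "g (snd z)"] dist_triangle_half_l[of _ _ \<kappa>]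
      by (metis dist_commute)
  qed
  ultimately show thesis by (rule that)
qed

text \<open>Approximate gluings with tolerance \<open>1 / real (Suc k)\<close> have a weakly
  convergent subsequence. The mismatch of \<open>f\<close> and \<open>g\<close>, truncated at 1, is
  a bounded continuous test function, so its integral vanishes in the limit. This is where
  measurability of the two maps no longer suffices and continuity enters.\<close>

lemma gluing:
  fixes f :: "'a::euclidean_space \<Rightarrow> 'c::{metric_space, second_countable_topology}" and g :: "'b::euclidean_space \<Rightarrow> 'c"
  assumes M: "prob_space M" "sets M = sets borel" and N: "prob_space N" "sets N = sets borel"
    and f: "continuous_on UNIV f" and g: "continuous_on UNIV g"
    and eq: "distr M borel f = distr N borel g"
  obtains P where "P \<in> couplings M N" "AE z in P. f (fst z) = g (snd z)"
proof -
  let ?\<kappa> = "\<lambda>k. 1 / real (Suc k)"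
  have "\<exists>P\<in>couplings M N. AE z in P. dist (f (fst z)) (g (snd z)) < ?\<kappa> k" for k
    by (rule approximate_gluing[OF M N _ _ eq, of "?\<kappa> k"])
       (use f g in \<open>auto intro: borel_measurable_continuous_onI\<close>)
  then obtain P where P: "\<And>k. P k \<in> couplings M N"
    and close: "\<And>k. AE z in P k. dist (f (fst z)) (g (snd z)) < ?\<kappa> k" by metis
  obtain r Q where r: "strict_mono r" and Q: "Q \<in> couplings M N" and conv: "converges_weakly (P \<circ> r) Q"
    by (rule couplings_compact[OF P])
  let ?h = "\<lambda>z. min 1 (dist (f (fst z)) (g (snd z)))"
  have cont: "continuous_on UNIV ?h"
    by (intro continuous_intros continuous_on_compose2[OF f] continuous_on_compose2[OF g]) auto
  have bdd: "\<bar>?h z\<bar> \<le> 1" for z by auto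
  note int = integrable_bounded_continuous[OF _ _ cont bdd]
  have "integral\<^sup>L (P k) ?h \<le> ?\<kappa> k" for k
  proof -
    interpret prob_space "P k" by (rule couplingsD[OF P])
    have "integral\<^sup>L (P k) ?h \<le> (\<integral>z. ?\<kappa> k \<partial>P k)"
    proof (rule integral_mono_AE)
      show "AE z in P k. ?h z \<le> ?\<kappa> k" using close[of k] by eventually_elim auto
    qed (use int couplingsD[OF P] in auto)
    then show ?thesis by (simp add: prob_space)
  qed
  then have "integral\<^sup>L ((P \<circ> r) k) ?h \<le> ?\<kappa> (r k)" for k by simp
  moreover have "?\<kappa> (r k) \<le> ?\<kappa> k" for k
    using seq_suble[OF r, of k] by (simp add: frac_le)
  ultimately have "integral\<^sup>L ((P \<circ> r) k) ?h \<le> ?\<kappa> k" for k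
    using order_trans by blast
  moreover have "?\<kappa> \<longlonglongrightarrow> 0" by (rule LIMSEQ_Suc[OF lim_1_over_n])
  ultimately have "integral\<^sup>L Q ?h \<le> 0"
    by (intro LIMSEQ_le[OF converges_weaklyD[OF conv cont bdd]]) auto
  moreover have "0 \<le> integral\<^sup>L Q ?h" by (rule integral_nonneg_AE) auto
  ultimately have "AE z in Q. ?h z = 0"
    using integral_nonneg_eq_0_iff_AE[of Q ?h] int couplingsD[OF Q] by auto
  then have "AE z in Q. f (fst z) = g (snd z)"
    by eventually_elim (auto simp: min_def split: if_splits)
  with Q show thesis by (rule that)
qed

section \<open>Square-integrable random variables and the Wasserstein distance\<close>

text \<open>Plans are handled as joint laws of random variables on one probability space, so the
  domain is an arbitrary measure space and the Hilbert space computations are done there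
  once.\<close>

definition square_integrable :: "'w measure \<Rightarrow> ('w \<Rightarrow> 'b::euclidean_space) \<Rightarrow> bool" where
  "square_integrable P X \<longleftrightarrow> X \<in> borel_measurable P \<and> integrable P (\<lambda>\<omega>. (norm (X \<omega>))\<^sup>2)"

named_theorems sq_intros

lemma square_integrable_measurable [measurable_dest]: "square_integrable P X \<Longrightarrow> X \<in> borel_measurable P"
  by (simp add: square_integrable_def)

lemma square_integrable_norm: "square_integrable P X \<Longrightarrow> integrable P (\<lambda>\<omega>. (norm (X \<omega>))\<^sup>2)"
  by (simp add: square_integrable_def)

lemma square_integrable_bound:
  assumes "X \<in> borel_measurable P" "integrable P f" "\<And>\<omega>. (norm (X \<omega>))\<^sup>2 \<le> f \<omega>"
  shows "square_integrable P X"
proof -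
  note [measurable] = assms(1)
  have "integrable P (\<lambda>\<omega>. (norm (X \<omega>))\<^sup>2)"
  proof (rule Bochner_Integration.integrable_bound[OF assms(2)])
    show "AE \<omega> in P. norm ((norm (X \<omega>))\<^sup>2) \<le> norm (f \<omega>)"
    proof (rule AE_I2)
      show "norm ((norm (X \<omega>))\<^sup>2) \<le> norm (f \<omega>)" for \<omega>
        using assms(3)[of \<omega>] abs_ge_self[of "f \<omega>"] by simp
    qed
  qed simp
  then show ?thesis using assms(1) by (simp add: square_integrable_def)
qed

lemma norm_add_sq_le: "(norm (x + y))\<^sup>2 \<le> 2 * (norm x)\<^sup>2 + 2 * (norm (y::'b::real_inner))\<^sup>2"
  using zero_le_power2[of "norm (x - y)"]
  unfolding power2_norm_eq_inner by (simp add: algebra_simps inner_commute)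

lemma square_integrable_add [sq_intros]:
  assumes "square_integrable P X" "square_integrable P Y"
  shows "square_integrable P (\<lambda>\<omega>. X \<omega> + Y \<omega>)"
proof (rule square_integrable_bound)
  show "integrable P (\<lambda>\<omega>. 2 * (norm (X \<omega>))\<^sup>2 + 2 * (norm (Y \<omega>))\<^sup>2)"
    using assms by (simp add: square_integrable_def)
  show "(\<lambda>\<omega>. X \<omega> + Y \<omega>) \<in> borel_measurable P"
    using assms[THEN square_integrable_measurable] by (rule borel_measurable_add)
qed (rule norm_add_sq_le)

lemma square_integrable_scaleR [sq_intros]:
  assumes "square_integrable P X"
  shows "square_integrable P (\<lambda>\<omega>. c *\<^sub>R X \<omega>)"
  using assms by (auto simp: square_integrable_def power_mult_distrib)

lemma square_integrable_diff [sq_intros]: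
  assumes "square_integrable P X" "square_integrable P Y"
  shows "square_integrable P (\<lambda>\<omega>. X \<omega> - Y \<omega>)"
  using square_integrable_add[OF assms(1) square_integrable_scaleR[OF assms(2), of "-1"]] by simp

lemma square_integrable_Pair [sq_intros]:
  assumes "square_integrable P X" "square_integrable P Y"
  shows "square_integrable P (\<lambda>\<omega>. (X \<omega>, Y \<omega>))"
  using assms by (auto simp: square_integrable_def norm_Pair borel_prod[symmetric])

lemma square_integrable_fst [sq_intros]:
  assumes "square_integrable P (X :: _ \<Rightarrow> 'b::euclidean_space \<times> 'c::euclidean_space)"
  shows "square_integrable P (\<lambda>\<omega>. fst (X \<omega>))"
proof (rule square_integrable_bound)
  show "(\<lambda>\<omega>. fst (X \<omega>)) \<in> borel_measurable P"
    using square_integrable_measurable[OF assms] unfolding borel_prod[symmetric] by measurable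
  show "(norm (fst (X \<omega>)))\<^sup>2 \<le> (norm (X \<omega>))\<^sup>2" for \<omega>
    using norm_fst_le[of "fst (X \<omega>)" "snd (X \<omega>)"] by (simp add: power_mono)
qed (rule square_integrable_norm[OF assms])

lemma square_integrable_snd [sq_intros]:
  assumes "square_integrable P (X :: _ \<Rightarrow> 'b::euclidean_space \<times> 'c::euclidean_space)"
  shows "square_integrable P (\<lambda>\<omega>. snd (X \<omega>))"
proof (rule square_integrable_bound)
  show "(\<lambda>\<omega>. snd (X \<omega>)) \<in> borel_measurable P"
    using square_integrable_measurable[OF assms] unfolding borel_prod[symmetric] by measurable
  show "(norm (snd (X \<omega>)))\<^sup>2 \<le> (norm (X \<omega>))\<^sup>2" for \<omega>
    using norm_snd_le[of "snd (X \<omega>)" "fst (X \<omega>)"] by (simp add: power_mono)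
qed (rule square_integrable_norm[OF assms])

lemma square_integrable_inner:
  assumes "square_integrable P X" "square_integrable P Y"
  shows "integrable P (\<lambda>\<omega>. X \<omega> \<bullet> Y \<omega>)"
proof -
  have eq: "(\<lambda>\<omega>. X \<omega> \<bullet> Y \<omega>) = (\<lambda>\<omega>. ((norm (X \<omega> + Y \<omega>))\<^sup>2 - (norm (X \<omega>))\<^sup>2 - (norm (Y \<omega>))\<^sup>2) / 2)"
    unfolding power2_norm_eq_inner by (auto simp: algebra_simps inner_commute)
  show ?thesis
    unfolding eq using square_integrable_norm[OF square_integrable_add[OF assms]] assms
    by (auto intro!: Bochner_Integration.integrable_diff integrable_divide simp: square_integrable_norm)
qed

lemma integral_norm_add_sq:
  assumes "square_integrable P X" "square_integrable P Y"
  shows "(\<integral>\<omega>. (norm (X \<omega> + s *\<^sub>R Y \<omega>))\<^sup>2 \<partial>P)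
    = (\<integral>\<omega>. (norm (X \<omega>))\<^sup>2 \<partial>P) + 2 * s * (\<integral>\<omega>. X \<omega> \<bullet> Y \<omega> \<partial>P) + s\<^sup>2 * (\<integral>\<omega>. (norm (Y \<omega>))\<^sup>2 \<partial>P)"
proof -
  have "(\<integral>\<omega>. (norm (X \<omega> + s *\<^sub>R Y \<omega>))\<^sup>2 \<partial>P)
      = (\<integral>\<omega>. (norm (X \<omega>))\<^sup>2 + 2 * s * (X \<omega> \<bullet> Y \<omega>) + s\<^sup>2 * (norm (Y \<omega>))\<^sup>2 \<partial>P)"
    unfolding power2_norm_eq_inner
    by (intro Bochner_Integration.integral_cong) (auto simp: algebra_simps inner_commute power2_eq_square)
  then show ?thesis
    using square_integrable_inner[OF assms] assms by (simp add: square_integrable_norm)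
qed

text \<open>Cauchy-Schwarz, with an upper bound in place of the norm of \<open>X\<close>. The square
  of the norm of \<open>X + s Y\<close> is a nonnegative quadratic polynomial in \<open>s\<close>,
  evaluated at its optimal point \<open>- (a / n)\<close>; if \<open>Y\<close> has norm zero the
  polynomial is affine in \<open>s\<close>, so its slope cannot be positive.\<close>

lemma integral_inner_le:
  assumes X: "square_integrable P X" and Y: "square_integrable P Y"
    and a: "(\<integral>\<omega>. (norm (X \<omega>))\<^sup>2 \<partial>P) \<le> a\<^sup>2" "0 < a"
  shows "(\<integral>\<omega>. X \<omega> \<bullet> Y \<omega> \<partial>P) \<le> a * sqrt (\<integral>\<omega>. (norm (Y \<omega>))\<^sup>2 \<partial>P)"
proof -
  define I where "I = (\<integral>\<omega>. X \<omega> \<bullet> Y \<omega> \<partial>P)"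
  define B where "B = (\<integral>\<omega>. (norm (Y \<omega>))\<^sup>2 \<partial>P)"
  define A where "A = (\<integral>\<omega>. (norm (X \<omega>))\<^sup>2 \<partial>P)"
  have B: "0 \<le> B" unfolding B_def by simp
  have "0 \<le> (\<integral>\<omega>. (norm (X \<omega> + s *\<^sub>R Y \<omega>))\<^sup>2 \<partial>P)" for s by simp
  then have *: "0 \<le> A + 2 * s * I + s\<^sup>2 * B" for s
    unfolding integral_norm_add_sq[OF X Y] A_def I_def B_def .
  show ?thesis
  proof (cases "B = 0")
    case True
    have "I \<le> 0"
    proof (rule ccontr)
      assume "\<not> I \<le> 0"
      then have "A + 2 * (- (A + 1) / (2 * I)) * I = - 1" by (simp add: field_simps)
      then show False using *[of "- (A + 1) / (2 * I)"] True by simp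
    qed
    then show ?thesis using True a by (simp add: I_def B_def)
  next
    case False
    define n where "n = sqrt B"
    have n: "0 < n" "B = n\<^sup>2" using B False by (auto simp: n_def)
    have "0 \<le> a\<^sup>2 + 2 * (- (a / n)) * I + (- (a / n))\<^sup>2 * n\<^sup>2"
      using *[of "- (a / n)", unfolded n(2)] a(1) unfolding A_def by linarith
    then have "2 * (a / n) * I \<le> 2 * a\<^sup>2" using n by (simp add: power_divide)
    then have "I \<le> a * n" using n a by (simp add: field_simps power2_eq_square)
    then show ?thesis by (simp add: I_def n_def B_def)
  qed
qed

section \<open>Laws with finite second moment and their couplings\<close>

lemma P2D:
  assumes "M \<in> P2"
  shows "prob_space M" "sets M = sets borel" "space M = UNIV" "square_integrable M (\<lambda>x. x)"
  using assms sets_eq_imp_space_eq[of M borel]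
  by (auto simp: P2_def square_integrable_def measurable_cong_sets[of M borel borel borel])

lemma distr_in_P2:
  assumes "prob_space P" "square_integrable P X"
  shows "distr P borel X \<in> P2"
  using assms square_integrable_measurable[OF assms(2)]
  by (auto simp: P2_def prob_space.prob_space_distr integrable_distr_eq square_integrable_norm)

lemma square_integrable_distr:
  assumes "distr P borel X \<in> P2" "X \<in> borel_measurable P"
  shows "square_integrable P X"
  using assms by (auto simp: P2_def square_integrable_def integrable_distr_eq)

lemma distr_distr_continuous:
  assumes "X \<in> borel_measurable P" "continuous_on UNIV h"
  shows "distr (distr P borel X) borel h = distr P borel (\<lambda>\<omega>. h (X \<omega>))"
  using assms by (subst distr_distr) (auto simp: comp_def borel_measurable_continuous_onI)

lemma integral_distr_continuous:
  fixes h :: "'b::topological_space \<Rightarrow> real"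
  assumes "X \<in> borel_measurable P" "continuous_on UNIV h"
  shows "integral\<^sup>L (distr P borel X) h = (\<integral>\<omega>. h (X \<omega>) \<partial>P)"
  using assms by (intro integral_distr) (auto simp: borel_measurable_continuous_onI)

lemma couplings_square_integrable:
  assumes "P \<in> couplings M N" "M \<in> P2" "N \<in> P2"
  shows "square_integrable P fst" "square_integrable P snd"
  using square_integrable_distr[of P fst] square_integrable_distr[of P snd] assms couplingsD[OF assms(1)]
  by auto

lemma couplings_in_P2:
  assumes "P \<in> couplings M N" "M \<in> P2" "N \<in> P2"
  shows "P \<in> P2"
proof -
  have "square_integrable P (\<lambda>z. (fst z, snd z))"
    using couplings_square_integrable[OF assms] by (rule square_integrable_Pair)
  then show ?thesis
    using couplingsD[OF assms(1)] by (simp add: P2_def square_integrable_def)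
qed

lemma couplings_distr:
  assumes "prob_space P" "X \<in> borel_measurable P" "Y \<in> borel_measurable P"
  shows "distr P borel (\<lambda>\<omega>. (X \<omega>, Y \<omega>)) \<in> couplings (distr P borel X) (distr P borel Y)"
proof -
  have m: "(\<lambda>\<omega>. (X \<omega>, Y \<omega>)) \<in> borel_measurable P"
    using assms by (simp add: borel_prod[symmetric])
  show ?thesis
    unfolding couplings_def using assms(1)
    by (auto simp: distr_distr_continuous[OF m] continuous_intros prob_space.prob_space_distr[OF assms(1) m])
qed

section \<open>The Wasserstein distance and optimal plans\<close>

lemma plans_eq_couplings:
  assumes "\<mu> \<in> P2" "\<sigma> \<in> P2"
  shows "plans \<mu> \<sigma> = couplings \<mu> \<sigma>"
  using couplings_in_P2[OF _ assms] by (auto simp: plans_def couplings_def P2_def)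

lemma transport_cost_eq: "transport_cost \<gamma> = (\<integral>z. (norm (fst z - snd z))\<^sup>2 \<partial>\<gamma>)"
  by (simp add: transport_cost_def split_beta')

lemma transport_cost_bdd_below: "bdd_below (transport_cost ` S)"
  by (rule bdd_belowI2[of _ 0]) (simp add: transport_cost_eq)

lemma transport_cost_nonneg: "0 \<le> transport_cost \<gamma>"
  unfolding transport_cost_eq by simp

text \<open>A gluing along a constant map is a coupling without constraint: both measures have the
  same image, a point mass.\<close>

lemma couplings_nonempty:
  assumes "\<mu> \<in> P2" "\<sigma> \<in> P2"
  shows "couplings \<mu> \<sigma> \<noteq> {}"
proof -
  note \<mu> = P2D[OF assms(1)] and \<sigma> = P2D[OF assms(2)]
  have "distr \<mu> borel (\<lambda>_. 0::real) = distr \<sigma> borel (\<lambda>_. 0::real)"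
    by (rule measure_eqI)
       (auto simp: emeasure_distr vimage_def \<mu>(3) \<sigma>(3)
         prob_space.emeasure_space_1[OF \<mu>(1), unfolded \<mu>(3)]
         prob_space.emeasure_space_1[OF \<sigma>(1), unfolded \<sigma>(3)])
  then show ?thesis
    using gluing[of \<mu> \<sigma> "\<lambda>_. 0::real" "\<lambda>_. 0"] P2D[OF assms(1)] P2D[OF assms(2)]
    by (metis continuous_on_const empty_iff)
qed

lemma wasserstein_sq:
  assumes "\<mu> \<in> P2" "\<sigma> \<in> P2"
  shows "(wasserstein \<mu> \<sigma>)\<^sup>2 = (INF \<gamma>\<in>couplings \<mu> \<sigma>. transport_cost \<gamma>)"
proof -
  have "0 \<le> (INF \<gamma>\<in>couplings \<mu> \<sigma>. transport_cost \<gamma>)"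
    using couplings_nonempty[OF assms] by (intro cINF_greatest transport_cost_nonneg)
  then show ?thesis
    by (simp add: wasserstein_def plans_eq_couplings[OF assms])
qed

lemma wasserstein_sq_le_cost:
  assumes "\<mu> \<in> P2" "\<sigma> \<in> P2" "\<gamma> \<in> couplings \<mu> \<sigma>"
  shows "(wasserstein \<mu> \<sigma>)\<^sup>2 \<le> transport_cost \<gamma>"
  unfolding wasserstein_sq[OF assms(1,2)]
  using assms(3) by (intro cINF_lower transport_cost_bdd_below)

lemma wasserstein_sq_le:
  assumes "prob_space P" "square_integrable P X" "square_integrable P Y"
  shows "(wasserstein (distr P borel X) (distr P borel Y))\<^sup>2 \<le> (\<integral>\<omega>. (norm (X \<omega> - Y \<omega>))\<^sup>2 \<partial>P)"
proof -
  have "(wasserstein (distr P borel X) (distr P borel Y))\<^sup>2 \<le> transport_cost (distr P borel (\<lambda>\<omega>. (X \<omega>, Y \<omega>)))"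
    using assms by (intro wasserstein_sq_le_cost distr_in_P2 couplings_distr) (auto dest: square_integrable_measurable)
  also have "\<dots> = (\<integral>\<omega>. (norm (X \<omega> - Y \<omega>))\<^sup>2 \<partial>P)"
    unfolding transport_cost_eq
    by (subst integral_distr_continuous)
       (auto intro!: continuous_intros square_integrable_measurable square_integrable_Pair assms)
  finally show ?thesis .
qed

lemma near_optimal_coupling:
  assumes "\<mu> \<in> P2" "\<sigma> \<in> P2" "0 < \<delta>"
  obtains \<gamma> where "\<gamma> \<in> couplings \<mu> \<sigma>" "transport_cost \<gamma> < (wasserstein \<mu> \<sigma>)\<^sup>2 + \<delta>"
proof -
  have "\<exists>\<gamma>\<in>couplings \<mu> \<sigma>. transport_cost \<gamma> < (wasserstein \<mu> \<sigma>)\<^sup>2 + \<delta>"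
    using assms(3) unfolding wasserstein_sq[OF assms(1,2)]
    using couplings_nonempty[OF assms(1,2)]
    by (subst cINF_less_iff[symmetric]) (simp_all add: transport_cost_bdd_below)
  then show thesis using that by blast
qed

lemma optimal_plans_iff:
  assumes "\<mu> \<in> P2" "\<sigma> \<in> P2"
  shows "\<gamma> \<in> optimal_plans \<mu> \<sigma> \<longleftrightarrow> \<gamma> \<in> couplings \<mu> \<sigma> \<and> transport_cost \<gamma> \<le> (wasserstein \<mu> \<sigma>)\<^sup>2"
proof -
  have "(\<forall>\<gamma>'\<in>couplings \<mu> \<sigma>. c \<le> transport_cost \<gamma>') \<longleftrightarrow> c \<le> (wasserstein \<mu> \<sigma>)\<^sup>2" for c
    unfolding wasserstein_sq[OF assms] using couplings_nonempty[OF assms]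
    by (subst le_cINF_iff) (simp_all add: transport_cost_bdd_below)
  then show ?thesis
    unfolding optimal_plans_def plans_eq_couplings[OF assms] by auto
qed

text \<open>The direct method: a minimising sequence of couplings has a weak limit, and the cost is
  lower semicontinuous. Its role is to make the hull nonempty.\<close>

lemma optimal_plan_exists:
  assumes "\<mu> \<in> P2" "\<sigma> \<in> P2"
  obtains \<gamma> where "\<gamma> \<in> optimal_plans \<mu> \<sigma>"
proof -
  let ?w = "(wasserstein \<mu> \<sigma>)\<^sup>2" and ?e = "\<lambda>k. 1 / real (Suc k)"
  have "\<exists>\<gamma>\<in>couplings \<mu> \<sigma>. transport_cost \<gamma> < ?w + ?e k" for k
    by (rule near_optimal_coupling[OF assms, of "?e k"]) auto
  then obtain \<gamma> where \<gamma>: "\<And>k. \<gamma> k \<in> couplings \<mu> \<sigma>" "\<And>k. transport_cost (\<gamma> k) < ?w + ?e k" by metis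
  obtain r \<gamma>' where r: "strict_mono r" and \<gamma>': "\<gamma>' \<in> couplings \<mu> \<sigma>" and conv: "converges_weakly (\<gamma> \<circ> r) \<gamma>'"
    by (rule couplings_compact[OF \<gamma>(1)])
  have int: "integrable \<gamma>'' (\<lambda>z. (norm (fst z - snd z))\<^sup>2)" if "\<gamma>'' \<in> couplings \<mu> \<sigma>" for \<gamma>''
    by (intro square_integrable_norm sq_intros couplings_square_integrable[OF that assms])
  have "transport_cost \<gamma>' \<le> ?w"
    unfolding transport_cost_eq
  proof (rule converges_weakly_integral_le[OF conv])
    show "(\<integral>z. (norm (fst z - snd z))\<^sup>2 \<partial>(\<gamma> \<circ> r) k) \<le> ?w + ?e (r k)" for k
      using \<gamma>(2)[of "r k"] by (simp add: transport_cost_eq)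
    show "(\<lambda>k. ?w + ?e (r k)) \<longlonglongrightarrow> ?w"
      using tendsto_add[OF tendsto_const LIMSEQ_subseq_LIMSEQ[OF LIMSEQ_Suc[OF lim_1_over_n] r], of ?w]
      by (simp add: comp_def)
  qed (auto intro!: continuous_intros int \<gamma>(1) \<gamma>' couplingsD(1,2)[OF \<gamma>(1)] couplingsD(1,2)[OF \<gamma>'])
  then show thesis
    using that \<gamma>' optimal_plans_iff[OF assms] by blast
qed

section \<open>Fibre plans and the superdifferential\<close>

lemma integral_coupling:
  fixes h :: "_ \<Rightarrow> real"
  assumes "P \<in> couplings M N"
  shows "continuous_on UNIV h \<Longrightarrow> (\<integral>z. h (fst z) \<partial>P) = integral\<^sup>L M h"
    and "continuous_on UNIV k \<Longrightarrow> (\<integral>z. k (snd z) \<partial>P) = integral\<^sup>L N (k :: _ \<Rightarrow> real)"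
  using integral_distr_continuous[OF couplingsD(5)[OF assms], of h]
    integral_distr_continuous[OF couplingsD(6)[OF assms], of k] couplingsD(3,4)[OF assms] by auto

lemma distr_coupling:
  assumes "P \<in> couplings M N"
  shows "continuous_on UNIV h \<Longrightarrow> distr P borel (\<lambda>z. h (fst z)) = distr M borel h"
    and "continuous_on UNIV k \<Longrightarrow> distr P borel (\<lambda>z. k (snd z)) = distr N borel k"
  using distr_distr_continuous[OF couplingsD(5)[OF assms], of h]
    distr_distr_continuous[OF couplingsD(6)[OF assms], of k] couplingsD(3,4)[OF assms] by auto

lemma gluing_P2:
  fixes f :: "'a::euclidean_space \<Rightarrow> 'c::{metric_space, second_countable_topology}" and g :: "'b::euclidean_space \<Rightarrow> 'c"
  assumes "M \<in> P2" "N \<in> P2" "continuous_on UNIV f" "continuous_on UNIV g" "distr M borel f = distr N borel g"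
  obtains P where "P \<in> couplings M N" "AE z in P. f (fst z) = g (snd z)"
    "square_integrable P fst" "square_integrable P snd"
proof -
  obtain P where P: "P \<in> couplings M N" "AE z in P. f (fst z) = g (snd z)"
    by (rule gluing[OF P2D(1,2)[OF assms(1)] P2D(1,2)[OF assms(2)] assms(3-5)])
  show thesis
    using that[OF P couplings_square_integrable[OF P(1) assms(1,2)]] .
qed

section \<open>Fibre plans and the fibre distance\<close>

lemma fibre_plans_iff:
  "\<eta> \<in> fibre_plans \<zeta> \<xi> \<longleftrightarrow> \<eta> \<in> P2 \<and> distr \<eta> borel (\<lambda>p. (fst p, fst (snd p))) = \<zeta>
     \<and> distr \<eta> borel (\<lambda>p. (fst p, snd (snd p))) = \<xi>"
  by (simp add: fibre_plans_def split_beta')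

lemma fibre_plansI:
  assumes "prob_space P" "square_integrable P X" "square_integrable P V" "square_integrable P W"
  shows "distr P borel (\<lambda>\<omega>. (X \<omega>, V \<omega>, W \<omega>)) \<in>
    fibre_plans (distr P borel (\<lambda>\<omega>. (X \<omega>, V \<omega>))) (distr P borel (\<lambda>\<omega>. (X \<omega>, W \<omega>)))"
proof -
  have sq: "square_integrable P (\<lambda>\<omega>. (X \<omega>, V \<omega>, W \<omega>))"
    by (intro sq_intros assms)
  note m = square_integrable_measurable[OF sq]
  have "distr (distr P borel (\<lambda>\<omega>. (X \<omega>, V \<omega>, W \<omega>))) borel (\<lambda>p. (fst p, fst (snd p)))
      = distr P borel (\<lambda>\<omega>. (X \<omega>, V \<omega>))"
    "distr (distr P borel (\<lambda>\<omega>. (X \<omega>, V \<omega>, W \<omega>))) borel (\<lambda>p. (fst p, snd (snd p)))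
      = distr P borel (\<lambda>\<omega>. (X \<omega>, W \<omega>))"
    by (subst distr_distr_continuous[OF m]; auto intro!: continuous_intros)+
  then show ?thesis
    unfolding fibre_plans_iff using distr_in_P2[OF assms(1) sq] by simp
qed

definition fibre_cost :: "('a::euclidean_space \<times> 'a \<times> 'a) measure \<Rightarrow> real" where
  "fibre_cost \<eta> = (\<integral>p. (norm (fst (snd p) - snd (snd p)))\<^sup>2 \<partial>\<eta>)"

lemma fibre_cost_nonneg: "0 \<le> fibre_cost \<eta>"
  by (simp add: fibre_cost_def)

lemma fibre_cost_bdd_below: "bdd_below (fibre_cost ` S)"
  by (rule bdd_belowI2[of _ 0]) (rule fibre_cost_nonneg)

lemma fibre_cost_distr:
  assumes "square_integrable P X" "square_integrable P V" "square_integrable P W"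
  shows "fibre_cost (distr P borel (\<lambda>\<omega>. (X \<omega>, V \<omega>, W \<omega>))) = (\<integral>\<omega>. (norm (V \<omega> - W \<omega>))\<^sup>2 \<partial>P)"
proof -
  have "square_integrable P (\<lambda>\<omega>. (X \<omega>, V \<omega>, W \<omega>))"
    by (intro sq_intros assms)
  then show ?thesis
    unfolding fibre_cost_def
    by (subst integral_distr_continuous) (auto intro!: continuous_intros dest: square_integrable_measurable)
qed

lemma fibre_dist_eq: "fibre_dist \<zeta> \<xi> = sqrt (INF \<eta>\<in>fibre_plans \<zeta> \<xi>. fibre_cost \<eta>)"
  by (simp add: fibre_dist_def fibre_cost_def split_beta')

lemma fibre_dist_sq_le_cost:
  assumes "\<eta> \<in> fibre_plans \<zeta> \<xi>" "0 \<le> e" "e \<le> fibre_dist \<zeta> \<xi>"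
  shows "e\<^sup>2 \<le> fibre_cost \<eta>"
proof -
  have "e \<le> sqrt (fibre_cost \<eta>)"
    using assms(3) unfolding fibre_dist_eq
    by (rule order_trans) (intro real_sqrt_le_mono cINF_lower assms(1) fibre_cost_bdd_below)
  then have "e\<^sup>2 \<le> (sqrt (fibre_cost \<eta>))\<^sup>2"
    using assms(2) by (rule power_mono)
  then show ?thesis by (simp add: fibre_cost_nonneg)
qed

lemma P2_overD:
  assumes "\<xi> \<in> P2_over \<mu>"
  shows "\<xi> \<in> P2" "distr \<xi> borel fst = \<mu>"
  using assms by (auto simp: P2_over_def)

lemma P2_over_distr:
  assumes "prob_space P" "square_integrable P X" "square_integrable P V" "distr P borel X = \<mu>"
  shows "distr P borel (\<lambda>\<omega>. (X \<omega>, V \<omega>)) \<in> P2_over \<mu>"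
proof -
  have sq: "square_integrable P (\<lambda>\<omega>. (X \<omega>, V \<omega>))"
    by (intro sq_intros assms)
  then show ?thesis
    unfolding P2_over_def using assms(1,4) distr_in_P2[OF assms(1) sq]
    by (auto simp: distr_distr_continuous[OF square_integrable_measurable[OF sq]] continuous_intros)
qed

lemma P2_over_first_marginal:
  assumes "distr P borel (\<lambda>\<omega>. (X \<omega>, V \<omega>)) \<in> P2_over \<mu>" "square_integrable P X" "square_integrable P V"
  shows "distr P borel X = \<mu>"
proof -
  have "square_integrable P (\<lambda>\<omega>. (X \<omega>, V \<omega>))"
    by (intro sq_intros assms)
  then show ?thesis
    using P2_overD(2)[OF assms(1)]
    by (subst (asm) distr_distr_continuous) (auto intro!: continuous_intros dest: square_integrable_measurable)
qed

text \<open>The two measures are glued along their base points. The base points then agree only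
  almost everywhere, so one of them is kept and the other replaced by it without changing the
  law.\<close>

lemma fibre_plans_nonempty:
  assumes "\<zeta> \<in> P2_over \<mu>" "\<xi> \<in> P2_over \<mu>"
  shows "fibre_plans \<zeta> \<xi> \<noteq> {}"
proof -
  have eq: "distr \<zeta> borel fst = distr \<xi> borel fst"
    using assms by (simp add: P2_over_def)
  have cont: "continuous_on UNIV (fst :: 'a \<times> 'a \<Rightarrow> 'a)" by (intro continuous_intros)
  obtain P where P: "P \<in> couplings \<zeta> \<xi>" and ae: "AE z in P. fst (fst z) = fst (snd z)"
    and sq [sq_intros]: "square_integrable P fst" "square_integrable P snd"
    by (rule gluing_P2[OF P2_overD(1)[OF assms(1)] P2_overD(1)[OF assms(2)] cont cont eq])
  have "distr P borel (\<lambda>z. (fst (fst z), snd (fst z), snd (snd z))) \<in>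
    fibre_plans (distr P borel (\<lambda>z. (fst (fst z), snd (fst z)))) (distr P borel (\<lambda>z. (fst (fst z), snd (snd z))))"
    by (intro fibre_plansI sq_intros couplingsD(2)[OF P])
  moreover have "distr P borel (\<lambda>z. (fst (fst z), snd (fst z))) = \<zeta>"
    using couplingsD(3)[OF P] by simp
  moreover have "distr P borel (\<lambda>z. (fst (fst z), snd (snd z))) = distr P borel (\<lambda>z. (fst (snd z), snd (snd z)))"
    using ae by (intro distr_cong_AE square_integrable_measurable sq_intros) auto
  moreover have "distr P borel (\<lambda>z. (fst (snd z), snd (snd z))) = \<xi>"
    using couplingsD(4)[OF P] by simp
  ultimately show ?thesis by auto
qed

lemma fibre_dist_less_obtain:
  assumes "\<zeta> \<in> P2_over \<mu>" "\<xi> \<in> P2_over \<mu>" "fibre_dist \<zeta> \<xi> < e"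
  obtains \<eta> where "\<eta> \<in> fibre_plans \<zeta> \<xi>" "fibre_cost \<eta> < e\<^sup>2"
proof -
  note ne = fibre_plans_nonempty[OF assms(1,2)]
  have nn: "0 \<le> (INF \<eta>\<in>fibre_plans \<zeta> \<xi>. fibre_cost \<eta>)"
    using ne by (intro cINF_greatest fibre_cost_nonneg)
  have "0 \<le> fibre_dist \<zeta> \<xi>" unfolding fibre_dist_eq using nn by simp
  then have "(fibre_dist \<zeta> \<xi>)\<^sup>2 < e\<^sup>2"
    using assms(3) by (intro power_strict_mono) auto
  then have "(INF \<eta>\<in>fibre_plans \<zeta> \<xi>. fibre_cost \<eta>) < e\<^sup>2"
    unfolding fibre_dist_eq using nn by simp
  then show thesis
    using that ne by (subst (asm) cINF_less_iff) (auto simp: fibre_cost_bdd_below)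
qed

text \<open>Convexity along every fibre plan, in terms of random variables: the joint law of
  \<open>V\<close> and \<open>W\<close> over \<open>X\<close> may be arbitrary.\<close>

lemma fibre_convexD:
  assumes D: "fibre_convex \<mu> D" and P: "prob_space P"
    and sq [sq_intros]: "square_integrable P X" "square_integrable P V" "square_integrable P W"
    and mem: "distr P borel (\<lambda>\<omega>. (X \<omega>, V \<omega>)) \<in> D" "distr P borel (\<lambda>\<omega>. (X \<omega>, W \<omega>)) \<in> D"
    and t: "0 \<le> t" "t \<le> 1"
  shows "distr P borel (\<lambda>\<omega>. (X \<omega>, (1 - t) *\<^sub>R V \<omega> + t *\<^sub>R W \<omega>)) \<in> D"
proof -
  have "distr (distr P borel (\<lambda>\<omega>. (X \<omega>, V \<omega>, W \<omega>))) borel (\<lambda>(x, v, w). (x, (1 - t) *\<^sub>R v + t *\<^sub>R w)) \<in> D"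
  proof -
    have "t \<in> {0..1}" using t by simp
    then show ?thesis
      using D mem fibre_plansI[OF P sq] unfolding fibre_convex_def by blast
  qed
  then show ?thesis
    unfolding split_beta'
    by (subst (asm) distr_distr_continuous)
       (auto intro!: continuous_intros square_integrable_measurable sq_intros)
qed

lemma fibre_convexI:
  assumes sub: "D \<subseteq> P2_over \<mu>"
    and conv: "\<And>\<eta> t. \<eta> \<in> P2 \<Longrightarrow> 0 \<le> t \<Longrightarrow> t \<le> 1 \<Longrightarrow>
      distr \<eta> borel (\<lambda>p. (fst p, fst (snd p))) \<in> D \<Longrightarrow> distr \<eta> borel (\<lambda>p. (fst p, snd (snd p))) \<in> D \<Longrightarrow>
      distr \<eta> borel (\<lambda>p. (fst p, (1 - t) *\<^sub>R fst (snd p) + t *\<^sub>R snd (snd p))) \<in> D"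
  shows "fibre_convex \<mu> D"
  unfolding fibre_convex_def
proof (intro conjI ballI)
  fix \<zeta> \<xi> \<eta> and t :: real
  assume "\<zeta> \<in> D" "\<xi> \<in> D" "t \<in> {0..1}" "\<eta> \<in> fibre_plans \<zeta> \<xi>"
  then show "distr \<eta> borel (\<lambda>(x, v, w). (x, (1 - t) *\<^sub>R v + t *\<^sub>R w)) \<in> D"
    using conv[of \<eta> t] unfolding fibre_plans_iff split_beta' by auto
qed (rule sub)

lemma fibre_convex_P2_over: "fibre_convex \<mu> (P2_over \<mu>)"
proof (rule fibre_convexI)
  fix \<eta> :: "('a \<times> 'a \<times> 'a) measure" and t :: real
  assume \<eta>: "\<eta> \<in> P2" and "distr \<eta> borel (\<lambda>p. (fst p, fst (snd p))) \<in> P2_over \<mu>"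
  note [sq_intros] = P2D(4)[OF \<eta>]
  have "distr \<eta> borel fst = \<mu>"
    by (rule P2_over_first_marginal[OF \<open>distr \<eta> borel (\<lambda>p. (fst p, fst (snd p))) \<in> P2_over \<mu>\<close>])
       (intro sq_intros)+
  then show "distr \<eta> borel (\<lambda>p. (fst p, (1 - t) *\<^sub>R fst (snd p) + t *\<^sub>R snd (snd p))) \<in> P2_over \<mu>"
    by (intro P2_over_distr P2D(1)[OF \<eta>] sq_intros)
qed simp

text \<open>The hull is an intersection of convex sets, and a fibre plan between two of its members
  is one between members of each of these sets. Convexity of \<open>P2_over \<mu>\<close> supplies a
  member of the family, so the hull lies over \<mu>.\<close>

lemma fibre_convex_hull:
  assumes "A \<subseteq> P2_over \<mu>"
  shows "fibre_convex \<mu> (fibre_convex \<mu> hull A)"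
proof (rule fibre_convexI)
  show "fibre_convex \<mu> hull A \<subseteq> P2_over \<mu>"
    by (rule hull_minimal[where S = "fibre_convex \<mu>", OF assms fibre_convex_P2_over])
  fix \<eta> :: "('a \<times> 'a \<times> 'a) measure" and t :: real
  assume \<eta>: "\<eta> \<in> P2" and t: "0 \<le> t" "t \<le> 1"
    and mem: "distr \<eta> borel (\<lambda>p. (fst p, fst (snd p))) \<in> fibre_convex \<mu> hull A"
      "distr \<eta> borel (\<lambda>p. (fst p, snd (snd p))) \<in> fibre_convex \<mu> hull A"
  note [sq_intros] = P2D(4)[OF \<eta>]
  have "distr \<eta> borel (\<lambda>p. (fst p, (1 - t) *\<^sub>R fst (snd p) + t *\<^sub>R snd (snd p))) \<in> D"
    if D: "fibre_convex \<mu> D" "A \<subseteq> D" for D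
    using mem hull_minimal[where S = "fibre_convex \<mu>", OF D(2,1)]
    by (intro fibre_convexD[OF D(1) P2D(1)[OF \<eta>]] sq_intros t) auto
  then show "distr \<eta> borel (\<lambda>p. (fst p, (1 - t) *\<^sub>R fst (snd p) + t *\<^sub>R snd (snd p))) \<in> fibre_convex \<mu> hull A"
    unfolding hull_def by auto
qed

section \<open>The superdifferential tested with random variables\<close>

lemma strong_superdifferential_iff:
  "\<xi> \<in> strong_superdifferential G \<mu> \<longleftrightarrow> \<xi> \<in> P2_over \<mu> \<and> (\<forall>\<epsilon>>0. \<exists>\<delta>>0. \<forall>\<beta>\<in>P2.
     distr \<beta> borel (\<lambda>z. (fst z, fst (snd z))) = \<xi> \<longrightarrow>
     sqrt (\<integral>z. (norm (snd (snd z) - fst z))\<^sup>2 \<partial>\<beta>) < \<delta> \<longrightarrow>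
     G (distr \<beta> borel (\<lambda>z. snd (snd z))) \<le> G \<mu> + (\<integral>z. fst (snd z) \<bullet> (snd (snd z) - fst z) \<partial>\<beta>)
       + \<epsilon> * sqrt (\<integral>z. (norm (snd (snd z) - fst z))\<^sup>2 \<partial>\<beta>))"
  by (simp add: strong_superdifferential_def split_beta' Let_def imp_conjL)

text \<open>The joint law of \<open>(X, V, Z)\<close> is a three-plan. Since \<delta> comes before
  the probability space, it serves all spaces over \<open>'w\<close> at once, in particular gluings
  with test plans chosen later.\<close>

lemma strong_superdifferentialE:
  fixes G :: "'a::euclidean_space measure \<Rightarrow> real"
  assumes \<xi>: "\<xi> \<in> strong_superdifferential G \<mu>" and "0 < \<epsilon>"
  obtains \<delta> where "0 < \<delta>"
    "\<And>(P :: 'w measure) X V Z. prob_space P \<Longrightarrow> square_integrable P X \<Longrightarrow> square_integrable P V \<Longrightarrow>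
       square_integrable P Z \<Longrightarrow> distr P borel (\<lambda>\<omega>. (X \<omega>, V \<omega>)) = \<xi> \<Longrightarrow>
       sqrt (\<integral>\<omega>. (norm (Z \<omega> - X \<omega>))\<^sup>2 \<partial>P) < \<delta> \<Longrightarrow>
       G (distr P borel Z) \<le> G \<mu> + (\<integral>\<omega>. V \<omega> \<bullet> (Z \<omega> - X \<omega>) \<partial>P)
         + \<epsilon> * sqrt (\<integral>\<omega>. (norm (Z \<omega> - X \<omega>))\<^sup>2 \<partial>P)"
proof -
  obtain \<delta> where \<delta>: "0 < \<delta>" and ineq: "\<And>\<beta>. \<beta> \<in> P2 \<Longrightarrow>
     distr \<beta> borel (\<lambda>z. (fst z, fst (snd z))) = \<xi> \<Longrightarrow>
     sqrt (\<integral>z. (norm (snd (snd z) - fst z))\<^sup>2 \<partial>\<beta>) < \<delta> \<Longrightarrow>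
     G (distr \<beta> borel (\<lambda>z. snd (snd z))) \<le> G \<mu> + (\<integral>z. fst (snd z) \<bullet> (snd (snd z) - fst z) \<partial>\<beta>)
       + \<epsilon> * sqrt (\<integral>z. (norm (snd (snd z) - fst z))\<^sup>2 \<partial>\<beta>)"
    using assms unfolding strong_superdifferential_iff by blast
  show thesis
  proof (rule that[OF \<delta>])
    fix P :: "'w measure" and X V Z :: "'w \<Rightarrow> 'a"
    assume P: "prob_space P" and sq [sq_intros]: "square_integrable P X" "square_integrable P V" "square_integrable P Z"
      and XV: "distr P borel (\<lambda>\<omega>. (X \<omega>, V \<omega>)) = \<xi>"
      and less: "sqrt (\<integral>\<omega>. (norm (Z \<omega> - X \<omega>))\<^sup>2 \<partial>P) < \<delta>"
    let ?\<beta> = "distr P borel (\<lambda>\<omega>. (X \<omega>, V \<omega>, Z \<omega>))"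
    have sqT: "square_integrable P (\<lambda>\<omega>. (X \<omega>, V \<omega>, Z \<omega>))" by (intro sq_intros)
    note m = square_integrable_measurable[OF sqT]
    have 1: "?\<beta> \<in> P2" by (rule distr_in_P2[OF P sqT])
    have 2: "distr ?\<beta> borel (\<lambda>z. (fst z, fst (snd z))) = \<xi>"
      using XV by (subst distr_distr_continuous[OF m]) (auto intro!: continuous_intros)
    have 3: "distr ?\<beta> borel (\<lambda>z. snd (snd z)) = distr P borel Z"
      by (subst distr_distr_continuous[OF m]) (auto intro!: continuous_intros)
    have 4: "(\<integral>z. (norm (snd (snd z) - fst z))\<^sup>2 \<partial>?\<beta>) = (\<integral>\<omega>. (norm (Z \<omega> - X \<omega>))\<^sup>2 \<partial>P)"
      by (subst integral_distr_continuous[OF m]) (auto intro!: continuous_intros)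
    have 5: "(\<integral>z. fst (snd z) \<bullet> (snd (snd z) - fst z) \<partial>?\<beta>) = (\<integral>\<omega>. V \<omega> \<bullet> (Z \<omega> - X \<omega>) \<partial>P)"
      by (subst integral_distr_continuous[OF m]) (auto intro!: continuous_intros)
    show "G (distr P borel Z) \<le> G \<mu> + (\<integral>\<omega>. V \<omega> \<bullet> (Z \<omega> - X \<omega>) \<partial>P)
         + \<epsilon> * sqrt (\<integral>\<omega>. (norm (Z \<omega> - X \<omega>))\<^sup>2 \<partial>P)"
      using ineq[OF 1 2] less unfolding 3 4 5 by simp
  qed
qed

section \<open>The superdifferential is convex, closed and contains the optimal plans\<close>

lemma strong_superdifferential_P2_over:
  "\<xi> \<in> strong_superdifferential G \<mu> \<Longrightarrow> \<xi> \<in> P2_over \<mu>"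
  by (simp add: strong_superdifferential_iff)

lemma integral_cong_AE_inner:
  assumes "square_integrable P X" "square_integrable P Y" "square_integrable P X'" "square_integrable P Y'"
    "AE \<omega> in P. X \<omega> = X' \<omega> \<and> Y \<omega> = Y' \<omega>"
  shows "(\<integral>\<omega>. X \<omega> \<bullet> Y \<omega> \<partial>P) = (\<integral>\<omega>. X' \<omega> \<bullet> Y' \<omega> \<partial>P)"
proof (rule integral_cong_AE)
  show "AE \<omega> in P. X \<omega> \<bullet> Y \<omega> = X' \<omega> \<bullet> Y' \<omega>"
    using assms(5) by eventually_elim simp
qed (use square_integrable_inner[OF assms(1,2)] square_integrable_inner[OF assms(3,4)] in auto)

text \<open>After a test plan \<beta> is glued to \<eta>, base point and tangent vector can be read
  off either factor. This carries all terms of the superdifferential inequality from \<beta> to the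
  coupling.\<close>

lemma glued_displacement:
  fixes \<beta> :: "('a::euclidean_space \<times> 'a \<times> 'a) measure" and \<eta> :: "'b::euclidean_space measure"
  assumes P: "P \<in> couplings \<eta> \<beta>" and sq: "square_integrable P fst" "square_integrable P snd"
    and X: "square_integrable P X" and V: "square_integrable P V"
    and ae: "AE z in P. (X z, V z) = (fst (snd z), fst (snd (snd z)))"
  shows "(\<integral>z. (norm (snd (snd (snd z)) - X z))\<^sup>2 \<partial>P) = (\<integral>z. (norm (snd (snd z) - fst z))\<^sup>2 \<partial>\<beta>)"
    and "(\<integral>z. V z \<bullet> (snd (snd (snd z)) - X z) \<partial>P) = (\<integral>z. fst (snd z) \<bullet> (snd (snd z) - fst z) \<partial>\<beta>)"
    and "distr P borel (\<lambda>z. snd (snd (snd z))) = distr \<beta> borel (\<lambda>z. snd (snd z))"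
proof -
  note [sq_intros] = sq X V
  have "(\<integral>z. (norm (snd (snd (snd z)) - X z))\<^sup>2 \<partial>P) = (\<integral>z. (norm (snd (snd (snd z)) - fst (snd z)))\<^sup>2 \<partial>P)"
    unfolding power2_norm_eq_inner using ae by (intro integral_cong_AE_inner sq_intros) auto
  also have "\<dots> = (\<integral>z. (norm (snd (snd z) - fst z))\<^sup>2 \<partial>\<beta>)"
    by (intro integral_coupling(2)[OF P] continuous_intros)
  finally show "(\<integral>z. (norm (snd (snd (snd z)) - X z))\<^sup>2 \<partial>P) = (\<integral>z. (norm (snd (snd z) - fst z))\<^sup>2 \<partial>\<beta>)" .
  have "(\<integral>z. V z \<bullet> (snd (snd (snd z)) - X z) \<partial>P)
      = (\<integral>z. fst (snd (snd z)) \<bullet> (snd (snd (snd z)) - fst (snd z)) \<partial>P)"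
    using ae by (intro integral_cong_AE_inner sq_intros) auto
  also have "\<dots> = (\<integral>z. fst (snd z) \<bullet> (snd (snd z) - fst z) \<partial>\<beta>)"
    by (intro integral_coupling(2)[OF P] continuous_intros)
  finally show "(\<integral>z. V z \<bullet> (snd (snd (snd z)) - X z) \<partial>P) = (\<integral>z. fst (snd z) \<bullet> (snd (snd z) - fst z) \<partial>\<beta>)" .
  show "distr P borel (\<lambda>z. snd (snd (snd z))) = distr \<beta> borel (\<lambda>z. snd (snd z))"
    by (intro distr_coupling(2)[OF P] continuous_intros)
qed

text \<open>Gluing a test plan for the averaged field to \<eta> splits its tangent vector into
  \<open>v\<close> and \<open>w\<close>. The inequalities for both hold with the same displacement
  and the same target measure, and the linear term is affine in the field, so their convex
  combination is the claim.\<close>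

lemma fibre_convex_strong_superdifferential:
  fixes G :: "'a::euclidean_space measure \<Rightarrow> real"
  shows "fibre_convex \<mu> (strong_superdifferential G \<mu>)"
proof (rule fibre_convexI)
  fix \<eta> :: "('a \<times> 'a \<times> 'a) measure" and t :: real
  assume \<eta>: "\<eta> \<in> P2" and t: "0 \<le> t" "t \<le> 1"
    and v: "distr \<eta> borel (\<lambda>p. (fst p, fst (snd p))) \<in> strong_superdifferential G \<mu>"
    and w: "distr \<eta> borel (\<lambda>p. (fst p, snd (snd p))) \<in> strong_superdifferential G \<mu>"
  let ?h = "\<lambda>p :: 'a \<times> 'a \<times> 'a. (fst p, (1 - t) *\<^sub>R fst (snd p) + t *\<^sub>R snd (snd p))"
  show "distr \<eta> borel ?h \<in> strong_superdifferential G \<mu>"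
    unfolding strong_superdifferential_iff
  proof (intro conjI allI impI)
    have "distr \<eta> borel (\<lambda>p. (fst p, fst (snd p))) \<in> P2_over \<mu>" "distr \<eta> borel (\<lambda>p. (fst p, snd (snd p))) \<in> P2_over \<mu>"
      using v w by (auto intro: strong_superdifferential_P2_over)
    then show "distr \<eta> borel ?h \<in> P2_over \<mu>"
      using P2D[OF \<eta>] by (intro fibre_convexD[OF fibre_convex_P2_over] sq_intros t) auto
    fix \<epsilon> :: real assume \<epsilon>: "0 < \<epsilon>"
    obtain \<delta>1 where \<delta>1: "0 < \<delta>1" and ineq1: "\<And>(P :: (('a \<times> 'a \<times> 'a) \<times> ('a \<times> 'a \<times> 'a)) measure) X V Z.
       prob_space P \<Longrightarrow> square_integrable P X \<Longrightarrow> square_integrable P V \<Longrightarrow>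
       square_integrable P Z \<Longrightarrow> distr P borel (\<lambda>\<omega>. (X \<omega>, V \<omega>)) = distr \<eta> borel (\<lambda>p. (fst p, fst (snd p))) \<Longrightarrow>
       sqrt (\<integral>\<omega>. (norm (Z \<omega> - X \<omega>))\<^sup>2 \<partial>P) < \<delta>1 \<Longrightarrow>
       G (distr P borel Z) \<le> G \<mu> + (\<integral>\<omega>. V \<omega> \<bullet> (Z \<omega> - X \<omega>) \<partial>P)
         + \<epsilon> * sqrt (\<integral>\<omega>. (norm (Z \<omega> - X \<omega>))\<^sup>2 \<partial>P)"
      by (rule strong_superdifferentialE[OF v \<epsilon>]) blast
    obtain \<delta>2 where \<delta>2: "0 < \<delta>2" and ineq2: "\<And>(P :: (('a \<times> 'a \<times> 'a) \<times> ('a \<times> 'a \<times> 'a)) measure) X V Z.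
       prob_space P \<Longrightarrow> square_integrable P X \<Longrightarrow> square_integrable P V \<Longrightarrow>
       square_integrable P Z \<Longrightarrow> distr P borel (\<lambda>\<omega>. (X \<omega>, V \<omega>)) = distr \<eta> borel (\<lambda>p. (fst p, snd (snd p))) \<Longrightarrow>
       sqrt (\<integral>\<omega>. (norm (Z \<omega> - X \<omega>))\<^sup>2 \<partial>P) < \<delta>2 \<Longrightarrow>
       G (distr P borel Z) \<le> G \<mu> + (\<integral>\<omega>. V \<omega> \<bullet> (Z \<omega> - X \<omega>) \<partial>P)
         + \<epsilon> * sqrt (\<integral>\<omega>. (norm (Z \<omega> - X \<omega>))\<^sup>2 \<partial>P)"
      by (rule strong_superdifferentialE[OF w \<epsilon>]) blast
    show "\<exists>\<delta>>0. \<forall>\<beta>\<in>P2. distr \<beta> borel (\<lambda>z. (fst z, fst (snd z))) = distr \<eta> borel ?h \<longrightarrow>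
       sqrt (\<integral>z. (norm (snd (snd z) - fst z))\<^sup>2 \<partial>\<beta>) < \<delta> \<longrightarrow>
       G (distr \<beta> borel (\<lambda>z. snd (snd z))) \<le> G \<mu> + (\<integral>z. fst (snd z) \<bullet> (snd (snd z) - fst z) \<partial>\<beta>)
         + \<epsilon> * sqrt (\<integral>z. (norm (snd (snd z) - fst z))\<^sup>2 \<partial>\<beta>)"
    proof (intro exI[of _ "min \<delta>1 \<delta>2"] conjI ballI impI)
      fix \<beta> :: "('a \<times> 'a \<times> 'a) measure"
      let ?n = "sqrt (\<integral>z. (norm (snd (snd z) - fst z))\<^sup>2 \<partial>\<beta>)"
      let ?\<nu> = "distr \<beta> borel (\<lambda>z. snd (snd z))"
      assume \<beta>: "\<beta> \<in> P2" and eq: "distr \<beta> borel (\<lambda>z. (fst z, fst (snd z))) = distr \<eta> borel ?h"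
        and n: "?n < min \<delta>1 \<delta>2"
      obtain P where P: "P \<in> couplings \<eta> \<beta>" and ae: "AE z in P. ?h (fst z) = (fst (snd z), fst (snd (snd z)))"
        and sq [sq_intros]: "square_integrable P fst" "square_integrable P snd"
        by (rule gluing_P2[OF \<eta> \<beta> _ _ eq[symmetric]]) (intro continuous_intros)+
      let ?D = "\<lambda>z. snd (snd (snd z)) - fst (fst z)"
      have ae': "AE z in P. (fst (fst z), (1 - t) *\<^sub>R fst (snd (fst z)) + t *\<^sub>R snd (snd (fst z)))
          = (fst (snd z), fst (snd (snd z)))"
        using ae by simp
      have gl: "(\<integral>z. (norm (?D z))\<^sup>2 \<partial>P) = (\<integral>z. (norm (snd (snd z) - fst z))\<^sup>2 \<partial>\<beta>)"
        "(\<integral>z. ((1 - t) *\<^sub>R fst (snd (fst z)) + t *\<^sub>R snd (snd (fst z))) \<bullet> ?D z \<partial>P)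
          = (\<integral>z. fst (snd z) \<bullet> (snd (snd z) - fst z) \<partial>\<beta>)"
        "distr P borel (\<lambda>z. snd (snd (snd z))) = ?\<nu>"
        by (rule glued_displacement[OF P sq _ _ ae'], (intro sq_intros)+)+
      have "G ?\<nu> \<le> G \<mu> + (\<integral>z. fst (snd (fst z)) \<bullet> ?D z \<partial>P) + \<epsilon> * ?n"
        unfolding gl[symmetric]
        using n gl by (intro ineq1 couplingsD(2)[OF P] sq_intros)
          (auto intro!: distr_coupling(1)[OF P] continuous_intros)
      then have 1: "(1 - t) * G ?\<nu> \<le> (1 - t) * (G \<mu> + (\<integral>z. fst (snd (fst z)) \<bullet> ?D z \<partial>P) + \<epsilon> * ?n)"
        using t by (intro mult_left_mono) auto
      have "G ?\<nu> \<le> G \<mu> + (\<integral>z. snd (snd (fst z)) \<bullet> ?D z \<partial>P) + \<epsilon> * ?n"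
        unfolding gl[symmetric]
        using n gl by (intro ineq2 couplingsD(2)[OF P] sq_intros)
          (auto intro!: distr_coupling(1)[OF P] continuous_intros)
      then have 2: "t * G ?\<nu> \<le> t * (G \<mu> + (\<integral>z. snd (snd (fst z)) \<bullet> ?D z \<partial>P) + \<epsilon> * ?n)"
        using t by (intro mult_left_mono) auto
      have i1: "integrable P (\<lambda>z. fst (snd (fst z)) \<bullet> ?D z)" and i2: "integrable P (\<lambda>z. snd (snd (fst z)) \<bullet> ?D z)"
        by (intro square_integrable_inner sq_intros)+
      have "(\<integral>z. ((1 - t) *\<^sub>R fst (snd (fst z)) + t *\<^sub>R snd (snd (fst z))) \<bullet> ?D z \<partial>P)
          = (\<integral>z. (1 - t) * (fst (snd (fst z)) \<bullet> ?D z) + t * (snd (snd (fst z)) \<bullet> ?D z) \<partial>P)"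
        by (simp add: inner_add_left)
      also have "\<dots> = (1 - t) * (\<integral>z. fst (snd (fst z)) \<bullet> ?D z \<partial>P) + t * (\<integral>z. snd (snd (fst z)) \<bullet> ?D z \<partial>P)"
        using i1 i2 by simp
      finally have 3: "(\<integral>z. fst (snd z) \<bullet> (snd (snd z) - fst z) \<partial>\<beta>)
          = (1 - t) * (\<integral>z. fst (snd (fst z)) \<bullet> ?D z \<partial>P) + t * (\<integral>z. snd (snd (fst z)) \<bullet> ?D z \<partial>P)"
        unfolding gl(2) .
      show "G ?\<nu> \<le> G \<mu> + (\<integral>z. fst (snd z) \<bullet> (snd (snd z) - fst z) \<partial>\<beta>) + \<epsilon> * ?n"
        using 1 2 unfolding 3 by (simp add: algebra_simps)
    qed (use \<delta>1 \<delta>2 in auto)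
  qed
qed (auto intro: strong_superdifferential_P2_over)

text \<open>Replacing the field of \<xi> by that of a nearby \<zeta> changes the linear term, by
  Cauchy-Schwarz, by at most their distance times the length of the displacement, which is an error
  of the admissible order. Half of \<epsilon> pays for this, the other half for the remainder at
  \<zeta>; \<zeta> is fixed by \<epsilon>, so \<delta> may depend on it.\<close>

lemma fibre_closure_strong_superdifferential:
  fixes G :: "'a::euclidean_space measure \<Rightarrow> real"
  assumes A: "A \<subseteq> strong_superdifferential G \<mu>"
  shows "fibre_closure \<mu> A \<subseteq> strong_superdifferential G \<mu>"
proof
  fix \<xi> assume "\<xi> \<in> fibre_closure \<mu> A"
  then have \<xi>: "\<xi> \<in> P2_over \<mu>" and close: "\<And>\<epsilon>. 0 < \<epsilon> \<Longrightarrow> \<exists>\<zeta>\<in>A. fibre_dist \<zeta> \<xi> < \<epsilon>"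
    by (auto simp: fibre_closure_def)
  show "\<xi> \<in> strong_superdifferential G \<mu>"
    unfolding strong_superdifferential_iff
  proof (intro conjI allI impI \<xi>)
    fix \<epsilon> :: real assume "0 < \<epsilon>"
    then have \<epsilon>: "0 < \<epsilon>/2" by simp
    obtain \<zeta> where "\<zeta> \<in> A" and dist: "fibre_dist \<zeta> \<xi> < \<epsilon>/2"
      using close[OF \<epsilon>] by blast
    then have \<zeta>: "\<zeta> \<in> strong_superdifferential G \<mu>" using A by blast
    obtain \<eta> where "\<eta> \<in> fibre_plans \<zeta> \<xi>" and cost: "fibre_cost \<eta> < (\<epsilon>/2)\<^sup>2"
      by (rule fibre_dist_less_obtain[OF strong_superdifferential_P2_over[OF \<zeta>] \<xi> dist])
    then have \<eta>: "\<eta> \<in> P2" and \<eta>\<zeta>: "distr \<eta> borel (\<lambda>p. (fst p, fst (snd p))) = \<zeta>"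
      and \<eta>\<xi>: "distr \<eta> borel (\<lambda>p. (fst p, snd (snd p))) = \<xi>"
      by (auto simp: fibre_plans_iff)
    obtain \<delta> where \<delta>: "0 < \<delta>" and ineq: "\<And>(P :: (('a \<times> 'a \<times> 'a) \<times> ('a \<times> 'a \<times> 'a)) measure) X V Z.
       prob_space P \<Longrightarrow> square_integrable P X \<Longrightarrow> square_integrable P V \<Longrightarrow>
       square_integrable P Z \<Longrightarrow> distr P borel (\<lambda>\<omega>. (X \<omega>, V \<omega>)) = \<zeta> \<Longrightarrow>
       sqrt (\<integral>\<omega>. (norm (Z \<omega> - X \<omega>))\<^sup>2 \<partial>P) < \<delta> \<Longrightarrow>
       G (distr P borel Z) \<le> G \<mu> + (\<integral>\<omega>. V \<omega> \<bullet> (Z \<omega> - X \<omega>) \<partial>P)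
         + \<epsilon>/2 * sqrt (\<integral>\<omega>. (norm (Z \<omega> - X \<omega>))\<^sup>2 \<partial>P)"
      by (rule strong_superdifferentialE[OF \<zeta> \<epsilon>]) blast
    show "\<exists>\<delta>>0. \<forall>\<beta>\<in>P2. distr \<beta> borel (\<lambda>z. (fst z, fst (snd z))) = \<xi> \<longrightarrow>
       sqrt (\<integral>z. (norm (snd (snd z) - fst z))\<^sup>2 \<partial>\<beta>) < \<delta> \<longrightarrow>
       G (distr \<beta> borel (\<lambda>z. snd (snd z))) \<le> G \<mu> + (\<integral>z. fst (snd z) \<bullet> (snd (snd z) - fst z) \<partial>\<beta>)
         + \<epsilon> * sqrt (\<integral>z. (norm (snd (snd z) - fst z))\<^sup>2 \<partial>\<beta>)"
    proof (intro exI[of _ \<delta>] conjI ballI impI \<delta>)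
      fix \<beta> :: "('a \<times> 'a \<times> 'a) measure"
      let ?n = "sqrt (\<integral>z. (norm (snd (snd z) - fst z))\<^sup>2 \<partial>\<beta>)"
      let ?\<nu> = "distr \<beta> borel (\<lambda>z. snd (snd z))"
      assume \<beta>: "\<beta> \<in> P2" and eq: "distr \<beta> borel (\<lambda>z. (fst z, fst (snd z))) = \<xi>" and n: "?n < \<delta>"
      have eq': "distr \<eta> borel (\<lambda>p. (fst p, snd (snd p))) = distr \<beta> borel (\<lambda>z. (fst z, fst (snd z)))"
        using eq \<eta>\<xi> by simp
      obtain P where P: "P \<in> couplings \<eta> \<beta>"
        and ae: "AE z in P. (fst (fst z), snd (snd (fst z))) = (fst (snd z), fst (snd (snd z)))"
        and sq [sq_intros]: "square_integrable P fst" "square_integrable P snd"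
        by (rule gluing_P2[OF \<eta> \<beta> _ _ eq']) (intro continuous_intros)+
      let ?D = "\<lambda>z. snd (snd (snd z)) - fst (fst z)"
      have gl: "(\<integral>z. (norm (?D z))\<^sup>2 \<partial>P) = (\<integral>z. (norm (snd (snd z) - fst z))\<^sup>2 \<partial>\<beta>)"
        "(\<integral>z. snd (snd (fst z)) \<bullet> ?D z \<partial>P) = (\<integral>z. fst (snd z) \<bullet> (snd (snd z) - fst z) \<partial>\<beta>)"
        "distr P borel (\<lambda>z. snd (snd (snd z))) = ?\<nu>"
        by (rule glued_displacement[OF P sq _ _ ae], (intro sq_intros)+)+
      have law: "distr P borel (\<lambda>z. (fst (fst z), fst (snd (fst z)))) = \<zeta>"
        unfolding \<eta>\<zeta>[symmetric] by (rule distr_coupling(1)[OF P]) (intro continuous_intros)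
      have 1: "G ?\<nu> \<le> G \<mu> + (\<integral>z. fst (snd (fst z)) \<bullet> ?D z \<partial>P) + \<epsilon>/2 * ?n"
        unfolding gl[symmetric]
        using n gl law by (intro ineq couplingsD(2)[OF P] sq_intros) auto
      have "(\<integral>z. (norm (fst (snd (fst z)) - snd (snd (fst z))))\<^sup>2 \<partial>P) = fibre_cost \<eta>"
        unfolding fibre_cost_def by (rule integral_coupling(1)[OF P]) (intro continuous_intros)
      then have "(\<integral>z. (fst (snd (fst z)) - snd (snd (fst z))) \<bullet> ?D z \<partial>P) \<le> \<epsilon>/2 * ?n"
        unfolding gl(1)[symmetric] using cost \<epsilon> by (intro integral_inner_le sq_intros) auto
      moreover have "(\<integral>z. (fst (snd (fst z)) - snd (snd (fst z))) \<bullet> ?D z \<partial>P)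
          = (\<integral>z. fst (snd (fst z)) \<bullet> ?D z \<partial>P) - (\<integral>z. snd (snd (fst z)) \<bullet> ?D z \<partial>P)"
      proof -
        have "integrable P (\<lambda>z. fst (snd (fst z)) \<bullet> ?D z)" "integrable P (\<lambda>z. snd (snd (fst z)) \<bullet> ?D z)"
          by (intro square_integrable_inner sq_intros)+
        then show ?thesis
          by (subst Bochner_Integration.integral_diff[symmetric]) (simp_all add: inner_diff_left)
      qed
      ultimately show "G ?\<nu> \<le> G \<mu> + (\<integral>z. fst (snd z) \<bullet> (snd (snd z) - fst z) \<partial>\<beta>) + \<epsilon> * ?n"
        using 1 unfolding gl(2) by simp
    qed
  qed
qed

lemma optimal_plan_in_superdifferential:
  fixes \<mu> \<sigma> :: "'a::euclidean_space measure"
  assumes \<mu>: "\<mu> \<in> P2" and \<sigma>: "\<sigma> \<in> P2" and opt: "\<gamma> \<in> optimal_plans \<mu> \<sigma>"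
  shows "distr \<gamma> borel (\<lambda>z. (fst z, 2 *\<^sub>R (fst z - snd z)))
    \<in> strong_superdifferential (\<lambda>\<nu>. (wasserstein \<nu> \<sigma>)\<^sup>2) \<mu>" (is "?\<xi> \<in> _")
proof -
  have \<gamma>: "\<gamma> \<in> couplings \<mu> \<sigma>" and cost: "transport_cost \<gamma> \<le> (wasserstein \<mu> \<sigma>)\<^sup>2"
    using opt optimal_plans_iff[OF \<mu> \<sigma>] by auto
  note [sq_intros] = couplings_square_integrable[OF \<gamma> \<mu> \<sigma>]
  have sq\<xi>: "square_integrable \<gamma> (\<lambda>z. (fst z, 2 *\<^sub>R (fst z - snd z)))" by (intro sq_intros)
  note m\<xi> = square_integrable_measurable[OF sq\<xi>]
  show ?thesis
    unfolding strong_superdifferential_iff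
  proof (intro conjI allI impI)
    show "?\<xi> \<in> P2_over \<mu>"
      by (intro P2_over_distr sq_intros couplingsD[OF \<gamma>])
    fix \<epsilon> :: real assume \<epsilon>: "0 < \<epsilon>"
    show "\<exists>\<delta>>0. \<forall>\<beta>\<in>P2. distr \<beta> borel (\<lambda>z. (fst z, fst (snd z))) = ?\<xi> \<longrightarrow>
       sqrt (\<integral>z. (norm (snd (snd z) - fst z))\<^sup>2 \<partial>\<beta>) < \<delta> \<longrightarrow>
       (wasserstein (distr \<beta> borel (\<lambda>z. snd (snd z))) \<sigma>)\<^sup>2
         \<le> (wasserstein \<mu> \<sigma>)\<^sup>2 + (\<integral>z. fst (snd z) \<bullet> (snd (snd z) - fst z) \<partial>\<beta>)
         + \<epsilon> * sqrt (\<integral>z. (norm (snd (snd z) - fst z))\<^sup>2 \<partial>\<beta>)"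
    \<comment> \<open>The remainder is exactly the square of the displacement length, so \<delta> =
      \<epsilon> works.\<close>
    proof (intro exI[of _ \<epsilon>] conjI ballI impI \<epsilon>)
      fix \<beta> :: "('a \<times> 'a \<times> 'a) measure"
      let ?N = "\<integral>z. (norm (snd (snd z) - fst z))\<^sup>2 \<partial>\<beta>"
      assume \<beta>: "\<beta> \<in> P2" and eq: "distr \<beta> borel (\<lambda>z. (fst z, fst (snd z))) = ?\<xi>" and n: "sqrt ?N < \<epsilon>"
      note [sq_intros] = P2D(4)[OF \<beta>]
      have m\<beta>: "(\<lambda>z. (fst z, fst (snd z))) \<in> borel_measurable \<beta>"
        by (intro square_integrable_measurable sq_intros)
      have \<sigma>_eq: "distr \<beta> borel (\<lambda>z. fst z - (1/2) *\<^sub>R fst (snd z)) = \<sigma>"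
      proof -
        have "distr \<beta> borel (\<lambda>z. fst z - (1/2) *\<^sub>R fst (snd z)) = distr ?\<xi> borel (\<lambda>z. fst z - (1/2) *\<^sub>R snd z)"
          unfolding eq[symmetric] by (subst distr_distr_continuous[OF m\<beta>]) (auto intro!: continuous_intros)
        also have "\<dots> = distr \<gamma> borel snd"
          by (subst distr_distr_continuous[OF m\<xi>]) (auto intro!: continuous_intros)
        finally show ?thesis using couplingsD(4)[OF \<gamma>] by simp
      qed
      have V: "(\<integral>z. (norm ((1/2) *\<^sub>R fst (snd z)))\<^sup>2 \<partial>\<beta>) = transport_cost \<gamma>"
      proof -
        have "(\<integral>z. (norm ((1/2) *\<^sub>R fst (snd z)))\<^sup>2 \<partial>\<beta>) = (\<integral>z. (norm ((1/2) *\<^sub>R snd z))\<^sup>2 \<partial>?\<xi>)"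
          unfolding eq[symmetric] by (subst integral_distr_continuous[OF m\<beta>]) (auto intro!: continuous_intros)
        also have "\<dots> = transport_cost \<gamma>"
          unfolding transport_cost_eq
          by (subst integral_distr_continuous[OF m\<xi>]) (auto intro!: continuous_intros)
        finally show ?thesis .
      qed
      have "(wasserstein (distr \<beta> borel (\<lambda>z. snd (snd z))) \<sigma>)\<^sup>2
          \<le> (\<integral>z. (norm (snd (snd z) - (fst z - (1/2) *\<^sub>R fst (snd z))))\<^sup>2 \<partial>\<beta>)"
        unfolding \<sigma>_eq[symmetric] by (intro wasserstein_sq_le P2D(1)[OF \<beta>] sq_intros)
      also have "\<dots> = (\<integral>z. (norm ((1/2) *\<^sub>R fst (snd z) + 1 *\<^sub>R (snd (snd z) - fst z)))\<^sup>2 \<partial>\<beta>)"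
        by (simp add: algebra_simps)
      also have "\<dots> = transport_cost \<gamma> + 2 * 1 * (\<integral>z. ((1/2) *\<^sub>R fst (snd z)) \<bullet> (snd (snd z) - fst z) \<partial>\<beta>) + 1\<^sup>2 * ?N"
        unfolding V[symmetric] by (intro integral_norm_add_sq sq_intros)
      also have "\<dots> = transport_cost \<gamma> + (\<integral>z. fst (snd z) \<bullet> (snd (snd z) - fst z) \<partial>\<beta>) + ?N"
        by simp
      also have "?N \<le> \<epsilon> * sqrt ?N"
      proof -
        have "sqrt ?N * sqrt ?N \<le> \<epsilon> * sqrt ?N"
          using n by (intro mult_right_mono) auto
        then show ?thesis by simp
      qed
      finally show "(wasserstein (distr \<beta> borel (\<lambda>z. snd (snd z))) \<sigma>)\<^sup>2
         \<le> (wasserstein \<mu> \<sigma>)\<^sup>2 + (\<integral>z. fst (snd z) \<bullet> (snd (snd z) - fst z) \<partial>\<beta>) + \<epsilon> * sqrt ?N"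
        using cost by simp
    qed
  qed
qed

section \<open>The superdifferential is contained in the closure of the hull\<close>

text \<open>A near-optimal plan starting at the image under \<open>Z\<close> is glued to \<eta>
  along \<open>Z\<close>, and the intermediate point is forgotten. Injectivity of \<open>Z\<close>
  is never at issue, and the plans for different \<open>Z\<close> all become couplings of the same
  two measures, hence lie in one compact set.\<close>

lemma near_optimal_perturbed_coupling:
  fixes \<eta> :: "('a::euclidean_space \<times> 'a \<times> 'a) measure" and \<sigma> :: "'a measure"
  assumes \<eta>: "\<eta> \<in> P2" and \<sigma>: "\<sigma> \<in> P2" and Z: "continuous_on UNIV Z" "square_integrable \<eta> Z" and \<delta>: "0 < \<delta>"
  obtains P where "P \<in> couplings \<eta> \<sigma>"
    "(\<integral>z. (norm (Z (fst z) - snd z))\<^sup>2 \<partial>P) < (wasserstein (distr \<eta> borel Z) \<sigma>)\<^sup>2 + \<delta>"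
proof -
  let ?\<nu> = "distr \<eta> borel Z"
  have \<nu>: "?\<nu> \<in> P2" using Z P2D[OF \<eta>] by (intro distr_in_P2)
  obtain \<gamma> where \<gamma>: "\<gamma> \<in> couplings ?\<nu> \<sigma>" and cost: "transport_cost \<gamma> < (wasserstein ?\<nu> \<sigma>)\<^sup>2 + \<delta>"
    by (rule near_optimal_coupling[OF \<nu> \<sigma> \<delta>])
  have cont: "continuous_on UNIV (fst :: 'a \<times> 'a \<Rightarrow> 'a)" by (intro continuous_intros)
  obtain Q where Q: "Q \<in> couplings \<eta> \<gamma>" and ae: "AE z in Q. Z (fst z) = fst (snd z)"
    and sq [sq_intros]: "square_integrable Q fst" "square_integrable Q snd"
    by (rule gluing_P2[OF \<eta> couplings_in_P2[OF \<gamma> \<nu> \<sigma>] Z(1) cont couplingsD(3)[OF \<gamma>, symmetric]])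
  have sqZ [sq_intros]: "square_integrable Q (\<lambda>z. Z (fst z))"
  proof (rule square_integrable_distr)
    show "(\<lambda>z. Z (fst z)) \<in> borel_measurable Q"
      using couplingsD(5)[OF Q] borel_measurable_continuous_onI[OF Z(1)] by (rule measurable_compose)
    show "distr Q borel (\<lambda>z. Z (fst z)) \<in> P2"
      unfolding distr_coupling(1)[OF Q Z(1)] by (rule \<nu>)
  qed
  let ?P = "distr Q borel (\<lambda>z. (fst z, snd (snd z)))"
  have sqP: "square_integrable Q (\<lambda>z. (fst z, snd (snd z)))" by (intro sq_intros sq)
  have "?P \<in> couplings (distr Q borel fst) (distr Q borel (\<lambda>z. snd (snd z)))"
    by (rule couplings_distr[OF couplingsD(2,5)[OF Q] square_integrable_measurable[OF square_integrable_snd[OF sq(2)]]])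
  moreover have "distr Q borel (\<lambda>z. snd (snd z)) = \<sigma>"
    using distr_coupling(2)[OF Q, of snd] couplingsD(4)[OF \<gamma>] by (simp add: continuous_intros)
  ultimately have P: "?P \<in> couplings \<eta> \<sigma>"
    using couplingsD(3)[OF Q] by simp
  have "(\<integral>z. (norm (Z (fst z) - snd z))\<^sup>2 \<partial>?P) = (\<integral>z. (norm (Z (fst z) - snd (snd z)))\<^sup>2 \<partial>Q)"
    by (subst integral_distr_continuous[OF square_integrable_measurable[OF sqP]])
       (auto intro!: continuous_intros continuous_on_compose2[OF Z(1)])
  also have "\<dots> = (\<integral>z. (norm (fst (snd z) - snd (snd z)))\<^sup>2 \<partial>Q)"
    unfolding power2_norm_eq_inner using ae by (intro integral_cong_AE_inner sq_intros sq) auto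
  also have "\<dots> = transport_cost \<gamma>"
    unfolding transport_cost_eq by (intro integral_coupling(2)[OF Q] continuous_intros)
  finally show thesis
    using that[OF P] cost by simp
qed

text \<open>Moving \<open>\<mu>\<close> by \<open>s (v - w)\<close>, the superdifferential bounds the squared distance from above, while
  near-optimal plans from the moved measure, pulled back to \<open>\<mu>\<close>, bound it from below. As \<open>s\<close> tends
  to 0 these plans converge to an optimal one.\<close>

lemma superdifferential_optimal_direction:
  fixes \<mu> \<sigma> :: "'a::euclidean_space measure"
  assumes \<mu>: "\<mu> \<in> P2" and \<sigma>: "\<sigma> \<in> P2" and \<eta>: "\<eta> \<in> P2"
    and \<xi>: "distr \<eta> borel (\<lambda>p. (fst p, snd (snd p))) \<in> strong_superdifferential (\<lambda>\<nu>. (wasserstein \<nu> \<sigma>)\<^sup>2) \<mu>"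
  obtains P where "P \<in> couplings \<eta> \<sigma>"
    "(\<integral>z. (norm (fst (fst z) - snd z))\<^sup>2 \<partial>P) \<le> (wasserstein \<mu> \<sigma>)\<^sup>2"
    "2 * (\<integral>z. (fst (fst z) - snd z) \<bullet> (fst (snd (fst z)) - snd (snd (fst z))) \<partial>P)
      \<le> (\<integral>p. snd (snd p) \<bullet> (fst (snd p) - snd (snd p)) \<partial>\<eta>)"
proof -
  define D :: "'a \<times> 'a \<times> 'a \<Rightarrow> 'a" where "D p = fst (snd p) - snd (snd p)" for p
  define w where "w = (wasserstein \<mu> \<sigma>)\<^sup>2"
  define E where "E = (\<integral>p. (norm (D p))\<^sup>2 \<partial>\<eta>)"
  define J where "J = (\<integral>p. snd (snd p) \<bullet> D p \<partial>\<eta>)"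
  define A :: "(('a \<times> 'a \<times> 'a) \<times> 'a) measure \<Rightarrow> real" where "A P = (\<integral>z. (norm (fst (fst z) - snd z))\<^sup>2 \<partial>P)" for P
  define I :: "(('a \<times> 'a \<times> 'a) \<times> 'a) measure \<Rightarrow> real" where "I P = (\<integral>z. (fst (fst z) - snd z) \<bullet> D (fst z) \<partial>P)" for P
  define e where "e k = 1 / real (Suc k)" for k
  have e: "0 < e k" "e k \<le> 1" for k by (auto simp: e_def)
  note sq\<eta> = P2D(4)[OF \<eta>]
  have E0: "0 \<le> E" unfolding E_def by simp
  have D_cont: "continuous_on UNIV D" unfolding D_def by (intro continuous_intros)
  have D_sq: "square_integrable \<eta> D" unfolding D_def by (intro sq_intros sq\<eta>)
  have \<eta>\<mu>: "distr \<eta> borel fst = \<mu>"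
    by (rule P2_over_first_marginal[OF strong_superdifferential_P2_over[OF \<xi>]]) (intro sq_intros sq\<eta>)+
  have sqP: "square_integrable P (\<lambda>z. fst (fst z))" "square_integrable P snd" "square_integrable P (\<lambda>z. D (fst z))"
    if "P \<in> couplings \<eta> \<sigma>" for P
    unfolding D_def by (intro sq_intros couplings_square_integrable[OF that \<eta> \<sigma>])+
  have expand: "(\<integral>z. (norm (fst (fst z) - snd z + s *\<^sub>R D (fst z)))\<^sup>2 \<partial>P) = A P + 2 * s * I P + s\<^sup>2 * E"
    if P: "P \<in> couplings \<eta> \<sigma>" for P s
  proof -
    have "(\<integral>z. (norm (D (fst z)))\<^sup>2 \<partial>P) = E"
      unfolding E_def by (rule integral_coupling(1)[OF P]) (intro continuous_intros D_cont)
    then show ?thesis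
      unfolding A_def I_def using sqP[OF P] by (subst integral_norm_add_sq) (auto intro!: sq_intros)
  qed
  have lower: "w \<le> A P" if P: "P \<in> couplings \<eta> \<sigma>" for P
  proof -
    have "distr P borel (\<lambda>z. fst (fst z)) = \<mu>"
      using distr_coupling(1)[OF P, of fst] \<eta>\<mu> by (simp add: continuous_intros)
    then show ?thesis
      unfolding w_def A_def
      using wasserstein_sq_le[OF couplingsD(2)[OF P] sqP(1,2)[OF P]] couplingsD(4)[OF P] by simp
  qed
  \<comment> \<open>A bound on the cost that is uniform over all couplings, from the parallelogram
    identity.\<close>
  define B where "B = 2 * (\<integral>p. (norm (fst p))\<^sup>2 \<partial>\<eta>) + 2 * (\<integral>y. (norm y)\<^sup>2 \<partial>\<sigma>)"
  have upper: "A P \<le> B" if P: "P \<in> couplings \<eta> \<sigma>" for P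
  proof -
    have "0 \<le> (\<integral>z. (norm (fst (fst z) + 1 *\<^sub>R snd z))\<^sup>2 \<partial>P)" by simp
    moreover have "A P = (\<integral>z. (norm (fst (fst z) + (-1) *\<^sub>R snd z))\<^sup>2 \<partial>P)"
      unfolding A_def by simp
    moreover have "(\<integral>z. (norm (fst (fst z)))\<^sup>2 \<partial>P) = (\<integral>p. (norm (fst p))\<^sup>2 \<partial>\<eta>)"
      by (rule integral_coupling(1)[OF P]) (intro continuous_intros)
    moreover have "(\<integral>z. (norm (snd z))\<^sup>2 \<partial>P) = (\<integral>y. (norm y)\<^sup>2 \<partial>\<sigma>)"
      by (rule integral_coupling(2)[OF P]) (intro continuous_intros)
    ultimately show ?thesis
      unfolding B_def integral_norm_add_sq[OF sqP(1,2)[OF P]] by simp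
  qed
  \<comment> \<open>The pairing needs a uniform lower bound, so that its contribution
    \<open>2 * s * I P\<close> to the cost cannot hide a nonvanishing excess of \<open>A P\<close>
    over \<open>w\<close> when \<open>s\<close> is small.\<close>
  have I_lower: "- 2 * I P \<le> B + E" if P: "P \<in> couplings \<eta> \<sigma>" for P
  proof -
    have "0 \<le> (\<integral>z. (norm (fst (fst z) - snd z + 1 *\<^sub>R D (fst z)))\<^sup>2 \<partial>P)" by simp
    then show ?thesis unfolding expand[OF P] using upper[OF P] by simp
  qed
  have "\<exists>P\<in>couplings \<eta> \<sigma>. \<exists>s>0. s \<le> e k \<and> A P + 2 * s * I P + s\<^sup>2 * E \<le> w + s * J + s * sqrt E * e k + s\<^sup>2" for k
  proof -
    obtain \<delta> where \<delta>: "0 < \<delta>" and ineq: "\<And>(P :: ('a \<times> 'a \<times> 'a) measure) X V Z.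
       prob_space P \<Longrightarrow> square_integrable P X \<Longrightarrow> square_integrable P V \<Longrightarrow> square_integrable P Z \<Longrightarrow>
       distr P borel (\<lambda>\<omega>. (X \<omega>, V \<omega>)) = distr \<eta> borel (\<lambda>p. (fst p, snd (snd p))) \<Longrightarrow>
       sqrt (\<integral>\<omega>. (norm (Z \<omega> - X \<omega>))\<^sup>2 \<partial>P) < \<delta> \<Longrightarrow>
       (wasserstein (distr P borel Z) \<sigma>)\<^sup>2 \<le> (wasserstein \<mu> \<sigma>)\<^sup>2 + (\<integral>\<omega>. V \<omega> \<bullet> (Z \<omega> - X \<omega>) \<partial>P)
         + e k * sqrt (\<integral>\<omega>. (norm (Z \<omega> - X \<omega>))\<^sup>2 \<partial>P)"
      by (rule strong_superdifferentialE[OF \<xi> e(1)]) blast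
    \<comment> \<open>The added 1 keeps the quotient meaningful when \<open>E = 0\<close> and makes
      the displacement length \<open>s * sqrt E\<close> strictly smaller than \<delta>.\<close>
    define s where "s = min (e k) (\<delta> / (sqrt E + 1))"
    have sE: "0 < sqrt E + 1" using E0 real_sqrt_ge_zero[of E] by linarith
    have s: "0 < s" "s \<le> e k" using e \<delta> sE by (auto simp: s_def)
    have "s \<le> \<delta> / (sqrt E + 1)" by (simp add: s_def)
    then have "s * (sqrt E + 1) \<le> \<delta>" using sE by (simp only: pos_le_divide_eq)
    then have s\<delta>: "s * sqrt E < \<delta>" using s by (simp add: algebra_simps)
    define Z where "Z p = fst p + s *\<^sub>R D p" for p
    have Z_cont: "continuous_on UNIV Z" unfolding Z_def by (intro continuous_intros D_cont)
    have Z_sq: "square_integrable \<eta> Z" unfolding Z_def by (intro sq_intros sq\<eta> D_sq)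
    have n: "(\<integral>p. (norm (Z p - fst p))\<^sup>2 \<partial>\<eta>) = s\<^sup>2 * E"
      unfolding Z_def E_def by (simp add: power_mult_distrib)
    then have n': "sqrt (\<integral>p. (norm (Z p - fst p))\<^sup>2 \<partial>\<eta>) = s * sqrt E"
      using s by (simp add: real_sqrt_mult)
    have J: "(\<integral>p. snd (snd p) \<bullet> (Z p - fst p) \<partial>\<eta>) = s * J"
      unfolding Z_def J_def by simp
    have up: "(wasserstein (distr \<eta> borel Z) \<sigma>)\<^sup>2 \<le> w + s * J + e k * (s * sqrt E)"
      unfolding w_def n'[symmetric] J[symmetric]
    proof (rule ineq[OF P2D(1)[OF \<eta>] _ _ Z_sq refl])
      show "sqrt (\<integral>p. (norm (Z p - fst p))\<^sup>2 \<partial>\<eta>) < \<delta>" unfolding n' by (rule s\<delta>)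
    qed (intro sq_intros sq\<eta>)+
    \<comment> \<open>The optimality error \<open>s\<^sup>2\<close> is of smaller order than
      \<open>s\<close>, so it still vanishes after the division by \<open>s\<close> below.\<close>
    obtain P where P: "P \<in> couplings \<eta> \<sigma>"
      and near: "(\<integral>z. (norm (Z (fst z) - snd z))\<^sup>2 \<partial>P) < (wasserstein (distr \<eta> borel Z) \<sigma>)\<^sup>2 + s\<^sup>2"
      by (rule near_optimal_perturbed_coupling[OF \<eta> \<sigma> Z_cont Z_sq, of "s\<^sup>2"]) (use s in auto)
    have "(\<integral>z. (norm (Z (fst z) - snd z))\<^sup>2 \<partial>P) = A P + 2 * s * I P + s\<^sup>2 * E"
      unfolding expand[OF P, symmetric] Z_def by (simp add: algebra_simps)
    then show ?thesis
      using P s near up by (intro bexI[of _ P] exI[of _ s]) (auto simp: mult_ac)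
  qed
  then obtain P s where P: "\<And>k. P k \<in> couplings \<eta> \<sigma>" and s: "\<And>k. 0 < s k" "\<And>k. s k \<le> e k"
    and main: "\<And>k. A (P k) + 2 * s k * I (P k) + (s k)\<^sup>2 * E \<le> w + s k * J + s k * sqrt E * e k + (s k)\<^sup>2"
    by metis
  \<comment> \<open>The zeroth-order terms cancel because \<open>w\<close> is a lower bound of the
    cost of every coupling; what remains is divided by \<open>s k\<close>.\<close>
  have I_upper: "2 * I (P k) \<le> J + (sqrt E + 1) * e k" for k
  proof -
    have "s k * (2 * I (P k)) \<le> s k * (J + sqrt E * e k + s k)"
      using main[of k] lower[OF P, of k] E0 by (simp add: algebra_simps power2_eq_square)
        (smt (verit) mult_nonneg_nonneg zero_le_square)
    then have "2 * I (P k) \<le> J + sqrt E * e k + s k" using s(1)[of k] by simp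
    then show ?thesis using s(2)[of k] by (simp add: algebra_simps)
  qed
  \<comment> \<open>A bound for \<open>J + sqrt E * e k + s k - 2 * I (P k)\<close>, from
    \<open>I_lower\<close> and \<open>s k \<le> e k \<le> 1\<close>.\<close>
  define C where "C = \<bar>J\<bar> + sqrt E + 1 + B + E"
  have A_upper: "A (P k) \<le> w + C * e k" for k
  proof -
    have "A (P k) \<le> w + s k * (J + sqrt E * e k + s k - 2 * I (P k))"
    proof -
      have "0 \<le> (s k)\<^sup>2 * E" using E0 by simp
      then show ?thesis using main[of k] by (simp add: algebra_simps power2_eq_square)
    qed
    also have "s k * (J + sqrt E * e k + s k - 2 * I (P k)) \<le> s k * C"
    proof (rule mult_left_mono)
      have "sqrt E * e k \<le> sqrt E * 1"
        using e(2)[of k] E0 by (intro mult_left_mono) auto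
      then show "J + sqrt E * e k + s k - 2 * I (P k) \<le> C"
        unfolding C_def using I_lower[OF P, of k] s(2)[of k] e(2)[of k] by linarith
    qed (use s(1)[of k] in simp)
    also have "s k * C \<le> e k * C"
    proof (rule mult_right_mono[OF s(2)])
      have "0 \<le> B" by (simp add: B_def)
      then show "0 \<le> C" using E0 by (simp add: C_def)
    qed
    finally show ?thesis by (simp add: mult.commute)
  qed
  obtain r Q where r: "strict_mono r" and Q: "Q \<in> couplings \<eta> \<sigma>" and conv: "converges_weakly (P \<circ> r) Q"
    by (rule couplings_compact[OF P])
  have e_lim: "(\<lambda>k. e (r k)) \<longlonglongrightarrow> 0"
    using LIMSEQ_subseq_LIMSEQ[OF LIMSEQ_Suc[OF lim_1_over_n] r] by (simp add: comp_def e_def)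
  have A_Q: "A Q \<le> w"
    unfolding A_def
  proof (rule converges_weakly_integral_le[OF conv])
    show "(\<integral>z. (norm (fst (fst z) - snd z))\<^sup>2 \<partial>(P \<circ> r) k) \<le> w + C * e (r k)" for k
      using A_upper[of "r k"] by (simp add: A_def)
    show "(\<lambda>k. w + C * e (r k)) \<longlonglongrightarrow> w"
      using tendsto_add[OF tendsto_const tendsto_mult_left[OF e_lim, of C], of w] by simp
    show "integrable ((P \<circ> r) k) (\<lambda>z. (norm (fst (fst z) - snd z))\<^sup>2)" for k
      using sqP[OF P, of "r k"] by (auto intro!: square_integrable_norm square_integrable_diff)
    show "integrable Q (\<lambda>z. (norm (fst (fst z) - snd z))\<^sup>2)"
      using sqP[OF Q] by (auto intro!: square_integrable_norm square_integrable_diff)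
  qed (auto intro!: continuous_intros couplingsD(1,2)[OF P] couplingsD(1,2)[OF Q])
  \<comment> \<open>The integrand of \<open>I\<close> is unbounded and has no sign. Completing the
    square with \<open>s = 1\<close> gives a nonnegative integrand of integral
    \<open>A + 2 * I + E\<close>, to which lower semicontinuity applies; then
    \<open>w \<le> A Q\<close> isolates \<open>I Q\<close>.\<close>
  have "(\<integral>z. (norm (fst (fst z) - snd z + 1 *\<^sub>R D (fst z)))\<^sup>2 \<partial>Q) \<le> w + J + E"
  proof (rule converges_weakly_integral_le[OF conv])
    show "(\<integral>z. (norm (fst (fst z) - snd z + 1 *\<^sub>R D (fst z)))\<^sup>2 \<partial>(P \<circ> r) k)
        \<le> w + J + E + (C + sqrt E + 1) * e (r k)" for k
      unfolding comp_def expand[OF P] using A_upper[of "r k"] I_upper[of "r k"] by (simp add: algebra_simps)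
    show "(\<lambda>k. w + J + E + (C + sqrt E + 1) * e (r k)) \<longlonglongrightarrow> w + J + E"
      using tendsto_add[OF tendsto_const tendsto_mult_left[OF e_lim, of "C + sqrt E + 1"], of "w + J + E"] by simp
    show "integrable ((P \<circ> r) k) (\<lambda>z. (norm (fst (fst z) - snd z + 1 *\<^sub>R D (fst z)))\<^sup>2)" for k
      using sqP[OF P, of "r k"]
      by (auto intro!: square_integrable_norm square_integrable_diff square_integrable_add)
    show "integrable Q (\<lambda>z. (norm (fst (fst z) - snd z + 1 *\<^sub>R D (fst z)))\<^sup>2)"
      using sqP[OF Q] by (auto intro!: square_integrable_norm square_integrable_diff square_integrable_add)
    show "continuous_on UNIV (\<lambda>z. (norm (fst (fst z) - snd z + 1 *\<^sub>R D (fst z)))\<^sup>2)"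
      unfolding D_def by (intro continuous_intros)
  qed (auto intro!: couplingsD(1,2)[OF P] couplingsD(1,2)[OF Q])
  then have "2 * I Q \<le> J"
    unfolding expand[OF Q] using lower[OF Q] by simp
  then show thesis
    using that[OF Q] A_Q unfolding A_def I_def J_def w_def D_def by simp
qed

text \<open>If \<open>\<xi>\<close> had positive distance from \<open>H\<close>, moving a nearly closest point of \<open>H\<close> towards the
  optimal direction found above would bring it strictly closer to \<open>\<xi>\<close>.\<close>

lemma superdifferential_subset_closure:
  fixes \<mu> \<sigma> :: "'a::euclidean_space measure"
  assumes \<mu>: "\<mu> \<in> P2" and \<sigma>: "\<sigma> \<in> P2"
    and H: "fibre_convex \<mu> H"
    and opt: "\<And>\<gamma>. \<gamma> \<in> optimal_plans \<mu> \<sigma> \<Longrightarrow> distr \<gamma> borel (\<lambda>z. (fst z, 2 *\<^sub>R (fst z - snd z))) \<in> H"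
  shows "strong_superdifferential (\<lambda>\<nu>. (wasserstein \<nu> \<sigma>)\<^sup>2) \<mu> \<subseteq> fibre_closure \<mu> H"
proof
  fix \<xi> assume \<xi>: "\<xi> \<in> strong_superdifferential (\<lambda>\<nu>. (wasserstein \<nu> \<sigma>)\<^sup>2) \<mu>"
  note \<xi>\<mu> = strong_superdifferential_P2_over[OF \<xi>]
  have H_sub: "H \<subseteq> P2_over \<mu>" using H by (simp add: fibre_convex_def)
  show "\<xi> \<in> fibre_closure \<mu> H"
  proof (rule ccontr)
    assume "\<xi> \<notin> fibre_closure \<mu> H"
    then obtain \<epsilon> where \<epsilon>: "0 < \<epsilon>" and far: "\<And>\<zeta>. \<zeta> \<in> H \<Longrightarrow> \<epsilon> \<le> fibre_dist \<zeta> \<xi>"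
      using \<xi>\<mu> by (auto simp: fibre_closure_def not_less)
    \<comment> \<open>Pooling the fibre plans of all members of \<open>H\<close> makes
      \<open>d\<close> the squared distance from \<open>H\<close> to \<xi>, so one infimum replaces
      a double one.\<close>
    define T where "T = (\<Union>\<zeta>\<in>H. fibre_plans \<zeta> \<xi>)"
    define d where "d = (INF \<eta>\<in>T. fibre_cost \<eta>)"
    have T: "T \<noteq> {}"
    proof -
      obtain \<gamma> where "\<gamma> \<in> optimal_plans \<mu> \<sigma>" by (rule optimal_plan_exists[OF \<mu> \<sigma>])
      then have "distr \<gamma> borel (\<lambda>z. (fst z, 2 *\<^sub>R (fst z - snd z))) \<in> H" by (rule opt)
      then show ?thesis
        using fibre_plans_nonempty[OF _ \<xi>\<mu>] H_sub unfolding T_def by blast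
    qed
    have d_le: "d \<le> fibre_cost \<eta>" if "\<eta> \<in> T" for \<eta>
      unfolding d_def using that by (rule cINF_lower[OF fibre_cost_bdd_below])
    have "\<epsilon>\<^sup>2 \<le> d"
      unfolding d_def using \<epsilon> far
      by (intro cINF_greatest[OF T]) (auto simp: T_def intro!: fibre_dist_sq_le_cost)
    then have d: "0 < d" using \<epsilon> zero_less_power[OF \<epsilon>, of 2] by linarith
    define w where "w = (wasserstein \<mu> \<sigma>)\<^sup>2"
    define N where "N = (\<integral>p. (norm (snd p))\<^sup>2 \<partial>\<xi>)"
    have nn: "0 \<le> w" "0 \<le> N" by (auto simp: w_def N_def)
    \<comment> \<open>Bounds the squared norm of \<open>U - V\<close>: it is at most twice those of
      \<open>U - W\<close> and \<open>V - W\<close>, where \<open>U\<close> contributes at most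
      \<open>4 * w\<close>, \<open>W\<close> contributes \<open>N\<close>, and the cost of the near
      minimiser is below \<open>d + 1\<close>. It must not depend on that minimiser, because
      \<open>t\<close> is fixed before it.\<close>
    define K where "K = 2 * (8 * w + 2 * N) + 2 * (d + 1)"
    have K: "0 < K" using nn d by (simp add: K_def)
    define t where "t = min 1 (d / K)"
    have t: "0 < t" "t \<le> 1" using d K by (auto simp: t_def)
    have tK: "t * K \<le> d" using K by (simp add: t_def min_def field_simps)
    \<comment> \<open>The slack is capped by 1 for the sake of \<open>K\<close>, and by
      \<open>t * d\<close> so that it is covered by the first-order gain.\<close>
    obtain \<eta> where "\<eta> \<in> T" and \<eta>_less: "fibre_cost \<eta> < d + min 1 (t * d)"
    proof -
      have "(INF \<eta>\<in>T. fibre_cost \<eta>) < d + min 1 (t * d)"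
        using d t unfolding d_def[symmetric] by simp
      then show thesis
        using that T by (subst (asm) cINF_less_iff) (auto simp: fibre_cost_bdd_below)
    qed
    then obtain \<zeta> where \<zeta>: "\<zeta> \<in> H" and \<eta>: "\<eta> \<in> P2" and \<eta>\<zeta>: "distr \<eta> borel (\<lambda>p. (fst p, fst (snd p))) = \<zeta>"
      and \<eta>\<xi>: "distr \<eta> borel (\<lambda>p. (fst p, snd (snd p))) = \<xi>"
      by (auto simp: T_def fibre_plans_iff)
    obtain P where P: "P \<in> couplings \<eta> \<sigma>"
      and P_opt: "(\<integral>z. (norm (fst (fst z) - snd z))\<^sup>2 \<partial>P) \<le> (wasserstein \<mu> \<sigma>)\<^sup>2"
      and P_dir: "2 * (\<integral>z. (fst (fst z) - snd z) \<bullet> (fst (snd (fst z)) - snd (snd (fst z))) \<partial>P)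
        \<le> (\<integral>p. snd (snd p) \<bullet> (fst (snd p) - snd (snd p)) \<partial>\<eta>)"
      by (rule superdifferential_optimal_direction[OF \<mu> \<sigma> \<eta> \<xi>[folded \<eta>\<xi>]])
    define X where "X z = fst (fst z)" for z :: "('a \<times> 'a \<times> 'a) \<times> 'a"
    define V where "V z = fst (snd (fst z))" for z :: "('a \<times> 'a \<times> 'a) \<times> 'a"
    define W where "W z = snd (snd (fst z))" for z :: "('a \<times> 'a \<times> 'a) \<times> 'a"
    define U where "U z = 2 *\<^sub>R (X z - snd z)" for z :: "('a \<times> 'a \<times> 'a) \<times> 'a"
    note sqs = couplings_square_integrable[OF P \<eta> \<sigma>]
    have sq: "square_integrable P X" "square_integrable P V" "square_integrable P W" "square_integrable P U"
      unfolding X_def V_def W_def U_def by (intro sq_intros sqs)+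
    note prob = couplingsD(2)[OF P]
    have XV: "distr P borel (\<lambda>z. (X z, V z)) = \<zeta>"
      unfolding X_def V_def \<eta>\<zeta>[symmetric] by (rule distr_coupling(1)[OF P]) (intro continuous_intros)
    have XW: "distr P borel (\<lambda>z. (X z, W z)) = \<xi>"
      unfolding X_def W_def \<eta>\<xi>[symmetric] by (rule distr_coupling(1)[OF P]) (intro continuous_intros)
    have X\<mu>: "distr P borel X = \<mu>"
      using \<xi>\<mu> unfolding XW[symmetric] by (rule P2_over_first_marginal) (intro sq)+
    have XU: "distr P borel (\<lambda>z. (X z, U z)) \<in> H"
    proof -
      let ?\<gamma> = "distr P borel (\<lambda>z. (X z, snd z))"
      have m: "(\<lambda>z. (X z, snd z)) \<in> borel_measurable P"
        by (intro square_integrable_measurable square_integrable_Pair sq sqs)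
      have "?\<gamma> \<in> couplings \<mu> \<sigma>"
        using couplings_distr[OF prob square_integrable_measurable[OF sq(1)] couplingsD(6)[OF P]]
        unfolding X\<mu> couplingsD(4)[OF P] .
      moreover have "transport_cost ?\<gamma> \<le> (wasserstein \<mu> \<sigma>)\<^sup>2"
      proof -
        have "transport_cost ?\<gamma> = (\<integral>z. (norm (fst (fst z) - snd z))\<^sup>2 \<partial>P)"
          unfolding transport_cost_eq
          by (subst integral_distr_continuous[OF m]) (auto intro!: continuous_intros simp: X_def)
        then show ?thesis using P_opt by simp
      qed
      ultimately have "?\<gamma> \<in> optimal_plans \<mu> \<sigma>"
        using optimal_plans_iff[OF \<mu> \<sigma>] by simp
      then have "distr ?\<gamma> borel (\<lambda>z. (fst z, 2 *\<^sub>R (fst z - snd z))) \<in> H" by (rule opt)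
      then show ?thesis
        by (subst (asm) distr_distr_continuous[OF m]) (auto intro!: continuous_intros simp: U_def)
    qed
    \<comment> \<open>The coupling of \<open>V\<close> with \<open>U\<close> is inherited from
      \<open>P\<close>, whose choice was dictated by \<open>V - W\<close>; convexity along optimal
      fibre plans alone would not allow this step.\<close>
    have "distr P borel (\<lambda>z. (X z, (1 - t) *\<^sub>R V z + t *\<^sub>R U z)) \<in> H"
      using t XV XU \<zeta> by (intro fibre_convexD[OF H prob sq(1,2,4)]) auto
    moreover have sqVU: "square_integrable P (\<lambda>z. (1 - t) *\<^sub>R V z + t *\<^sub>R U z)"
      by (intro sq_intros sq)
    ultimately have "distr P borel (\<lambda>z. (X z, (1 - t) *\<^sub>R V z + t *\<^sub>R U z, W z)) \<in> T"
      unfolding T_def using fibre_plansI[OF prob sq(1) sqVU sq(3)] XW by auto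
    from d_le[OF this] have "d \<le> (\<integral>z. (norm ((1 - t) *\<^sub>R V z + t *\<^sub>R U z - W z))\<^sup>2 \<partial>P)"
      unfolding fibre_cost_distr[OF sq(1) sqVU sq(3)] .
    also have "\<dots> = (\<integral>z. (norm ((V z - W z) + t *\<^sub>R (U z - V z)))\<^sup>2 \<partial>P)"
      by (simp add: algebra_simps)
    also have "\<dots> = (\<integral>z. (norm (V z - W z))\<^sup>2 \<partial>P) + 2 * t * (\<integral>z. (V z - W z) \<bullet> (U z - V z) \<partial>P)
        + t\<^sup>2 * (\<integral>z. (norm (U z - V z))\<^sup>2 \<partial>P)"
      by (intro integral_norm_add_sq sq_intros sq)
    finally have expand: "d \<le> (\<integral>z. (norm (V z - W z))\<^sup>2 \<partial>P) + 2 * t * (\<integral>z. (V z - W z) \<bullet> (U z - V z) \<partial>P)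
        + t\<^sup>2 * (\<integral>z. (norm (U z - V z))\<^sup>2 \<partial>P)" .
    have VW: "(\<integral>z. (norm (V z - W z))\<^sup>2 \<partial>P) = fibre_cost \<eta>"
      unfolding fibre_cost_def V_def W_def by (rule integral_coupling(1)[OF P]) (intro continuous_intros)
    \<comment> \<open>Write \<open>U - V\<close> as \<open>(U - W) - (V - W)\<close>: the choice of
      \<open>P\<close> makes the pairing of the first part with \<open>V - W\<close> nonpositive,
      and the second part gives minus the cost.\<close>
    have "(\<integral>z. (V z - W z) \<bullet> (U z - V z) \<partial>P) \<le> - fibre_cost \<eta>"
    proof -
      have "(\<integral>z. (V z - W z) \<bullet> (U z - V z) \<partial>P)
          = (\<integral>z. U z \<bullet> (V z - W z) - W z \<bullet> (V z - W z) - (V z - W z) \<bullet> (V z - W z) \<partial>P)"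
        by (intro Bochner_Integration.integral_cong) (auto simp: algebra_simps inner_commute)
      also have "\<dots> = (\<integral>z. U z \<bullet> (V z - W z) \<partial>P) - (\<integral>z. W z \<bullet> (V z - W z) \<partial>P)
          - (\<integral>z. (V z - W z) \<bullet> (V z - W z) \<partial>P)"
        using square_integrable_inner[OF sq(4) square_integrable_diff[OF sq(2,3)]]
          square_integrable_inner[OF sq(3) square_integrable_diff[OF sq(2,3)]]
          square_integrable_inner[OF square_integrable_diff[OF sq(2,3)] square_integrable_diff[OF sq(2,3)]]
        by simp
      also have "(\<integral>z. (V z - W z) \<bullet> (V z - W z) \<partial>P) = fibre_cost \<eta>"
        unfolding VW[symmetric] power2_norm_eq_inner ..
      also have "(\<integral>z. U z \<bullet> (V z - W z) \<partial>P)
          = 2 * (\<integral>z. (fst (fst z) - snd z) \<bullet> (fst (snd (fst z)) - snd (snd (fst z))) \<partial>P)"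
        by (simp add: U_def X_def V_def W_def)
      also have "(\<integral>z. W z \<bullet> (V z - W z) \<partial>P) = (\<integral>p. snd (snd p) \<bullet> (fst (snd p) - snd (snd p)) \<partial>\<eta>)"
        unfolding V_def W_def by (rule integral_coupling(1)[OF P]) (intro continuous_intros)
      finally show ?thesis using P_dir by simp
    qed
    then have dir: "2 * t * (\<integral>z. (V z - W z) \<bullet> (U z - V z) \<partial>P) \<le> 2 * t * (- d)"
      using t d_le[OF \<open>\<eta> \<in> T\<close>] by (intro mult_left_mono) auto
    have "(\<integral>z. (norm (U z - V z))\<^sup>2 \<partial>P) \<le> K"
    proof -
      have ineq: "(norm (a - b))\<^sup>2 \<le> 2 * (norm a)\<^sup>2 + 2 * (norm b)\<^sup>2" for a b :: 'a
        using norm_add_sq_le[of a "- b"] by simp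
      have int: "integrable P (\<lambda>z. (norm (U z - W z))\<^sup>2)" "integrable P (\<lambda>z. (norm (V z - W z))\<^sup>2)"
        "integrable P (\<lambda>z. (norm (U z - V z))\<^sup>2)" "integrable P (\<lambda>z. (norm (U z))\<^sup>2)" "integrable P (\<lambda>z. (norm (W z))\<^sup>2)"
        by (intro square_integrable_norm sq_intros sq)+
      have "(\<integral>z. (norm (U z - V z))\<^sup>2 \<partial>P) \<le> (\<integral>z. 2 * (norm (U z - W z))\<^sup>2 + 2 * (norm (V z - W z))\<^sup>2 \<partial>P)"
      proof (rule integral_mono)
        show "(norm (U z - V z))\<^sup>2 \<le> 2 * (norm (U z - W z))\<^sup>2 + 2 * (norm (V z - W z))\<^sup>2" for z
          using ineq[of "U z - W z" "V z - W z"] by simp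
      qed (use int in auto)
      also have "\<dots> = 2 * (\<integral>z. (norm (U z - W z))\<^sup>2 \<partial>P) + 2 * fibre_cost \<eta>"
        using int VW by simp
      also have "(\<integral>z. (norm (U z - W z))\<^sup>2 \<partial>P) \<le> (\<integral>z. 2 * (norm (U z))\<^sup>2 + 2 * (norm (W z))\<^sup>2 \<partial>P)"
        using int by (intro integral_mono ineq) auto
      also have "\<dots> = 2 * (\<integral>z. (norm (U z))\<^sup>2 \<partial>P) + 2 * (\<integral>z. (norm (W z))\<^sup>2 \<partial>P)"
        using int by simp
      also have "(\<integral>z. (norm (W z))\<^sup>2 \<partial>P) = N"
      proof -
        have "(\<integral>z. (norm (W z))\<^sup>2 \<partial>P) = (\<integral>p. (norm (snd p))\<^sup>2 \<partial>distr P borel (\<lambda>z. (X z, W z)))"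
          by (subst integral_distr_continuous)
             (auto intro!: continuous_intros square_integrable_measurable square_integrable_Pair sq)
        then show ?thesis by (simp add: N_def XW)
      qed
      also have "(\<integral>z. (norm (U z))\<^sup>2 \<partial>P) \<le> 4 * w"
        using P_opt by (simp add: U_def X_def w_def power_mult_distrib)
      finally show ?thesis
        using \<eta>_less unfolding K_def by (simp add: algebra_simps)
    qed
    then have "t\<^sup>2 * (\<integral>z. (norm (U z - V z))\<^sup>2 \<partial>P) \<le> t\<^sup>2 * K"
      by (intro mult_left_mono) auto
    also have "t\<^sup>2 * K \<le> t * d"
      using mult_left_mono[OF tK, of t] t by (simp add: power2_eq_square mult_ac)
    \<comment> \<open>The summands are the near-minimal cost with its slack, the first-order gain
      and the second-order term. They add up to \<open>d\<close>, and the strict inequality in the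
      choice of \<eta> gives the contradiction.\<close>
    finally have "d < d + t * d + 2 * t * (- d) + t * d"
      using expand dir \<eta>_less unfolding VW by linarith
    then show False by simp
  qed
qed

theorem propositionA8:
  fixes \<mu> \<sigma> :: "'a::euclidean_space measure"
  assumes "\<mu> \<in> P2" and "\<sigma> \<in> P2"
  shows "strong_superdifferential (\<lambda>\<nu>. (wasserstein \<nu> \<sigma>)\<^sup>2) \<mu> =
    fibre_closure \<mu> (fibre_convex \<mu> hull
      {distr \<gamma> borel (\<lambda>(x, y). (x, (-2) *\<^sub>R (y - x))) | \<gamma>. \<gamma> \<in> optimal_plans \<mu> \<sigma>})"
proof -
  let ?S = "strong_superdifferential (\<lambda>\<nu>. (wasserstein \<nu> \<sigma>)\<^sup>2) \<mu>"
  let ?A = "{distr \<gamma> borel (\<lambda>(x, y). (x, (-2) *\<^sub>R (y - x))) | \<gamma>. \<gamma> \<in> optimal_plans \<mu> \<sigma>}"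
  have eq: "(\<lambda>(x, y). (x, (-2) *\<^sub>R (y - x))) = (\<lambda>z :: 'a \<times> 'a. (fst z, 2 *\<^sub>R (fst z - snd z)))"
    by (auto simp: algebra_simps)
  have A: "?A \<subseteq> ?S"
    unfolding eq using optimal_plan_in_superdifferential[OF assms] by auto
  have "fibre_convex \<mu> hull ?A \<subseteq> ?S"
    using A fibre_convex_strong_superdifferential by (rule hull_minimal)
  then have "fibre_closure \<mu> (fibre_convex \<mu> hull ?A) \<subseteq> ?S"
    by (rule fibre_closure_strong_superdifferential)
  moreover have "?S \<subseteq> fibre_closure \<mu> (fibre_convex \<mu> hull ?A)"
  proof (rule superdifferential_subset_closure[OF assms])
    show "fibre_convex \<mu> (fibre_convex \<mu> hull ?A)"
      using A strong_superdifferential_P2_over by (intro fibre_convex_hull) blast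
    show "distr \<gamma> borel (\<lambda>z. (fst z, 2 *\<^sub>R (fst z - snd z))) \<in> fibre_convex \<mu> hull ?A"
      if "\<gamma> \<in> optimal_plans \<mu> \<sigma>" for \<gamma>
      using that unfolding eq by (intro hull_inc) auto
  qed
  ultimately show ?thesis by blast
qed

end
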